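(* Let $d\ge 1$. There exists a nonzero radial function $f:\mathbb{R}^d\to\mathbb{R}$, $f\in L^1(\mathbb{R}^d)$, such that $\widehat f=f$, $f(0)=\widehat f(0)=0$, and $A(f)=\mathbf{A}$.
   Context: The Fourier transform on $\mathbb{R}^d$ is normalized by $\widehat f(y)=\int_{\mathbb{R}^d} f(x)e^{-2\pi i x\cdot y}\,dx$. For a real-valued function $g$ on $\mathbb{R}^d$, $A(g):=\inf\{r>0:\ g(x)\ge 0\text{ for all }|x|>r\}\in[0,\infty]$ (with $A(g)=\infty$ if no such $r$ exists). Let $\mathcal{A}$ denote the set of nonzero, even, integrable functions $f:\mathbb{R}^d\to\mathbb{R}$ with integrable Fourier transform such that $f(0)\le 0$ and $\widehat f(0)\le 0$. (Evenness makes $\widehat f$ real-valued; integrable functions with integrable Fourier transform are identified with their continuous representatives.) Set $$\mathbf{A}:=\inf_{f\in\mathcal{A}}\sqrt{A(f)A(\widehat f)} .$$ *)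

theory Defs
  imports "HOL-Analysis.Analysis"
begin

definition fourier :: "(real ^ 'n \<Rightarrow> complex) \<Rightarrow> real ^ 'n \<Rightarrow> complex" where
  "fourier f y =
     (LINT x|lborel. f x * exp (- (2 * complex_of_real pi * \<i> * complex_of_real (x \<bullet> y))))"

text \<open>
  For even integrable \<open>f\<close> the Fourier transform is real-valued, so taking the real part
  only changes the type; see \<open>fourier_even\<close> below.
\<close>

definition fourier_real :: "(real ^ 'n \<Rightarrow> real) \<Rightarrow> real ^ 'n \<Rightarrow> real" where
  "fourier_real f y = Re (fourier (\<lambda>x. complex_of_real (f x)) y)"

lemma fourier_even:
  fixes f :: "real ^ 'n \<Rightarrow> real"
  assumes int: "integrable lborel f" and even: "\<And>x. f (- x) = f x"
  shows "fourier (\<lambda>x. complex_of_real (f x)) y = complex_of_real (fourier_real f y)"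
proof -
  define g where
    "g x = complex_of_real (f x) *
       exp (- (2 * complex_of_real pi * \<i> * complex_of_real (x \<bullet> y)))" for x
  have [measurable]: "f \<in> borel_measurable borel"
    using borel_measurable_integrable[OF int] by simp
  have g: "g \<in> borel_measurable borel"
    unfolding g_def
  proof (rule borel_measurable_times)
    show "(\<lambda>x. complex_of_real (f x)) \<in> borel_measurable borel"
      by measurable
  qed (intro borel_measurable_continuous_onI continuous_intros)
  have reflect: "distr lborel borel uminus = (lborel :: (real ^ 'n) measure)"
    using lborel_affine[of "-1" "0 :: real ^ 'n"] by (simp add: density_1)
  have "cnj (integral\<^sup>L lborel g) = (LINT x|lborel. cnj (g x))"
    by simp
  also have "\<dots> = (LINT x|lborel. g (- x))"
    by (simp add: g_def even exp_cnj)
  also have "\<dots> = integral\<^sup>L (distr lborel borel uminus) g"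
    using g by (subst integral_distr) auto
  also have "\<dots> = integral\<^sup>L lborel g"
    by (simp add: reflect)
  finally have "cnj (fourier (\<lambda>x. complex_of_real (f x)) y) =
      fourier (\<lambda>x. complex_of_real (f x)) y"
    unfolding fourier_def g_def .
  then show ?thesis
    by (simp add: fourier_real_def complex_eq_iff)
qed

text \<open>The infimum of the empty set is \<open>\<infinity>\<close> in \<^typ>\<open>ennreal\<close>.\<close>

definition last_sign_change :: "(real ^ 'n \<Rightarrow> real) \<Rightarrow> ennreal" where
  "last_sign_change g = Inf (ennreal ` {r. r > 0 \<and> (\<forall>x. norm x > r \<longrightarrow> g x \<ge> 0)})"

text \<open>
  Continuity selects the continuous representative of the \<open>L\<^sup>1\<close> class of \<open>f\<close>; it makes the
  pointwise conditions meaningful. The Fourier integral of an integrable function is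
  automatically continuous.
\<close>

definition admissible :: "(real ^ 'n \<Rightarrow> real) set" where
  "admissible = {f. f \<noteq> (\<lambda>x. 0) \<and> (\<forall>x. f (- x) = f x) \<and> continuous_on UNIV f \<and>
     integrable lborel f \<and> integrable lborel (fourier (\<lambda>x. complex_of_real (f x))) \<and>
     f 0 \<le> 0 \<and> fourier_real f 0 \<le> 0}"

definition ennreal_sqrt :: "ennreal \<Rightarrow> ennreal" where
  "ennreal_sqrt x = (if x = \<infinity> then \<infinity> else ennreal (sqrt (enn2real x)))"

text \<open>
  The convention \<open>0 * \<infinity> = 0\<close> of \<^typ>\<open>ennreal\<close> plays no role in the product below: a
  continuous \<open>f\<close> that is nonnegative away from the origin and has integral at most \<open>0\<close>
  vanishes identically, so \<open>last_sign_change f > 0\<close> for admissible \<open>f\<close>, and likewise for the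
  transform, by Fourier inversion.
\<close>

definition uncertainty_inf :: "'n::finite itself \<Rightarrow> ennreal" where
  "uncertainty_inf _ = (INF f \<in> (admissible :: (real ^ 'n \<Rightarrow> real) set).
     ennreal_sqrt (last_sign_change f * last_sign_change (fourier_real f)))"

end

theory Submission
  imports Defs "HOL-Probability.Characteristic_Functions" "HOL-Complex_Analysis.Great_Picard"
begin

text \<open>
  Why an extremizer exists. The problem reduces to self-dual functions, those with
  \<open>fourier g = g\<close>: a dilation of an admissible \<open>f\<close> balances the two
  radii of \<open>f\<close> and of its transform without changing their product, and adding the
  transform to the balanced function makes it self-dual (\<open>symmetrized_competitor\<close>,
  \<open>competitor_above_product\<close>). So for every \<open>R\<close> above the infimum
  there is a nonzero self-dual \<open>g\<close> with \<open>g 0 \<le> 0\<close> and \<open>g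
  \<ge> 0\<close> beyond radius \<open>R\<close>. Such functions form a convex set
  \<open>competitors R\<close> that is invariant under rotations, and what has to be shown is
  that some nonzero limit survives as \<open>R\<close> decreases to the infimum.

  Compactness has two ingredients. The first is that a fixed share of the mass stays in the ball
  \<open>B\<close> of radius \<open>R\<close>: by \<open>inner_mass_uniform\<close> the
  \<open>L\<^sup>1\<close> norm of a competitor is at most a constant times the negated integral
  over \<open>B\<close>. If it were not, there would be a sequence of competitors of norm one
  whose mass outside \<open>B\<close> tends to 0. Then their transforms, that is the functions
  themselves, are equicontinuous up to a vanishing error, and by Arzela-Ascoli a subsequence
  converges to a nonzero function that is supported in \<open>B\<close> together with its
  transform. No such function exists, because the transform is entire along every line
  (\<open>fourier_zero_of_compact_supports\<close>).

  Hence the normalization \<open>ball_integral R g = -1\<close> bounds \<open>g\<close> in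
  \<open>L\<^sup>1\<close>, and, by self-duality, uniformly. This normalization is linear, so
  the normalized competitors still form convex sets, and the second ingredient applies: by the
  parallelogram law, near minimizers of a Hilbert norm in a decreasing sequence of convex sets
  form a Cauchy sequence (\<open>nested_midpoint_convex_near_minimizers\<close>). This yields
  convergence almost everywhere. It also yields radial symmetry without any averaging over the
  rotation group: a rotated near minimizer is again a near minimizer, so it is asymptotically
  equal to the original one.

  The limit is self-dual, since self-duality can be tested against Gaussians
  (\<open>AE_limit_self_dual\<close>); it is nonzero, because the normalization passes to the
  limit by dominated convergence on \<open>B\<close>; and Fatou's lemma outside \<open>B\<close>
  gives that its integral, which is its value at 0, is at most 0. Finally the Gaussian is
  self-dual, radial and positive, so adding the right nonnegative multiple of it to the limit
  makes the value at 0 vanish without creating new negative values.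
\<close>

section \<open>Lebesgue measure under shifts, orthogonal maps and dilations\<close>

lemma nn_integral_lborel_shift:
  fixes c :: "'a::euclidean_space" and f :: "'a \<Rightarrow> ennreal"
  assumes [measurable]: "f \<in> borel_measurable borel"
  shows "(\<integral>\<^sup>+x. f (c + x) \<partial>lborel) = (\<integral>\<^sup>+x. f x \<partial>lborel)"
proof -
  have "(\<integral>\<^sup>+x. f x \<partial>lborel) = (\<integral>\<^sup>+x. f x \<partial>distr lborel borel ((+) c))"
    by (simp only: lborel_distr_plus)
  also have "\<dots> = (\<integral>\<^sup>+x. f (c + x) \<partial>lborel)"
    by (subst nn_integral_distr) auto
  finally show ?thesis by simp
qed

lemma continuous_on_orthogonal: "orthogonal_transformation Q \<Longrightarrow> continuous_on A Q"
  for Q :: "'a::euclidean_space \<Rightarrow> 'a"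
  by (intro linear_continuous_on linear_conv_bounded_linear[THEN iffD1] orthogonal_transformation_linear)

lemma borel_measurable_orthogonal: "orthogonal_transformation Q \<Longrightarrow> Q \<in> borel_measurable borel"
  for Q :: "'a::euclidean_space \<Rightarrow> 'a"
  by (intro borel_measurable_continuous_onI continuous_on_orthogonal)

text \<open>
  Translation invariance determines Lebesgue measure up to a factor, and the unit ball, which
  every orthogonal map fixes, shows that the factor is 1. Concretely, the integral of \<open>b y
  * g (Q x + y)\<close> over both variables is evaluated in two ways, where \<open>b\<close> is
  the indicator of the unit ball.
\<close>

lemma nn_integral_lborel_orthogonal:
  fixes Q :: "'a::euclidean_space \<Rightarrow> 'a" and g :: "'a \<Rightarrow> ennreal"
  assumes Q: "orthogonal_transformation Q" and [measurable]: "g \<in> borel_measurable borel"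
  shows "(\<integral>\<^sup>+x. g (Q x) \<partial>lborel) = (\<integral>\<^sup>+x. g x \<partial>lborel)"
proof -
  have lin: "linear Q" using Q by (simp add: orthogonal_transformation_linear)
  have [measurable]: "Q \<in> borel_measurable borel" by (rule borel_measurable_orthogonal[OF Q])
  obtain P where P: "\<And>x. Q (P x) = x"
    using orthogonal_transformation_surj[OF Q] by (metis surj_f_inv_f)
  define b where "b x = (indicator (ball 0 1) x :: ennreal)" for x :: 'a
  have [measurable]: "b \<in> borel_measurable borel"
    unfolding b_def by (intro borel_measurable_indicator) simp
  have b_norm: "b x = b y" if "norm x = norm y" for x y
    using that by (simp add: b_def indicator_def)
  define V where "V = (\<integral>\<^sup>+x. b x \<partial>lborel)"
  have V: "V = emeasure lborel (ball (0::'a) 1)" unfolding V_def b_def by simp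
  have "V * (\<integral>\<^sup>+x. g (Q x) \<partial>lborel) = (\<integral>\<^sup>+y. b y * (\<integral>\<^sup>+x. g (Q x) \<partial>lborel) \<partial>lborel)"
    unfolding V_def by (simp add: nn_integral_multc)
  also have "\<dots> = (\<integral>\<^sup>+y. b y * (\<integral>\<^sup>+x. g (Q (P y + x)) \<partial>lborel) \<partial>lborel)"
    by (subst nn_integral_lborel_shift[of "\<lambda>x. g (Q x)"]) auto
  also have "\<dots> = (\<integral>\<^sup>+y. b y * (\<integral>\<^sup>+x. g (Q x + y) \<partial>lborel) \<partial>lborel)"
    by (simp add: linear_add[OF lin] P add.commute)
  also have "\<dots> = (\<integral>\<^sup>+y. (\<integral>\<^sup>+x. b y * g (Q x + y) \<partial>lborel) \<partial>lborel)"
    by (simp add: nn_integral_cmult)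
  also have "\<dots> = (\<integral>\<^sup>+x. (\<integral>\<^sup>+y. b y * g (Q x + y) \<partial>lborel) \<partial>lborel)"
    by (subst lborel_pair.Fubini') auto
  also have "\<dots> = (\<integral>\<^sup>+x. (\<integral>\<^sup>+y. b (y - Q x) * g y \<partial>lborel) \<partial>lborel)"
  proof (rule nn_integral_cong)
    fix x
    show "(\<integral>\<^sup>+y. b y * g (Q x + y) \<partial>lborel) = (\<integral>\<^sup>+y. b (y - Q x) * g y \<partial>lborel)"
      using nn_integral_lborel_shift[of "\<lambda>y. b (y - Q x) * g y" "Q x"] by simp
  qed
  also have "\<dots> = (\<integral>\<^sup>+y. (\<integral>\<^sup>+x. b (y - Q x) * g y \<partial>lborel) \<partial>lborel)"
    by (subst lborel_pair.Fubini') auto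
  also have "\<dots> = (\<integral>\<^sup>+y. (\<integral>\<^sup>+x. b (y - Q x) \<partial>lborel) * g y \<partial>lborel)"
    by (simp add: nn_integral_multc)
  also have "\<dots> = (\<integral>\<^sup>+y. V * g y \<partial>lborel)"
  proof (intro nn_integral_cong arg_cong2[where f="(*)"] refl)
    fix y
    have "norm (y - Q x) = norm (- P y + x)" for x
    proof -
      have "y - Q x = Q (P y - x)" by (simp add: linear_diff[OF lin] P)
      then show ?thesis using orthogonal_transformation_norm[OF Q] by (simp add: norm_minus_commute)
    qed
    then have "(\<integral>\<^sup>+x. b (y - Q x) \<partial>lborel) = (\<integral>\<^sup>+x. b (- P y + x) \<partial>lborel)"
      by (intro nn_integral_cong b_norm)
    then show "(\<integral>\<^sup>+x. b (y - Q x) \<partial>lborel) = V"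
      unfolding V_def using nn_integral_lborel_shift[of b "- P y"] by simp
  qed
  also have "\<dots> = V * (\<integral>\<^sup>+x. g x \<partial>lborel)"
    by (simp add: nn_integral_cmult)
  finally have eq: "V * (\<integral>\<^sup>+x. g (Q x) \<partial>lborel) = V * (\<integral>\<^sup>+x. g x \<partial>lborel)" .
  have "V \<noteq> top" unfolding V using emeasure_lborel_ball_finite[of "0::'a" 1] by simp
  moreover have "V \<noteq> 0"
    unfolding V using open_not_negligible[of "ball (0::'a) 1"]
    by (auto simp: negligible_iff_null_sets null_sets_def)
  ultimately show ?thesis using eq by (simp add: ennreal_mult_cancel_left)
qed

lemma lborel_distr_orthogonal:
  fixes Q :: "'a::euclidean_space \<Rightarrow> 'a"
  assumes Q: "orthogonal_transformation Q"
  shows "distr lborel borel Q = lborel"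
proof (rule measure_eqI)
  fix A :: "'a set" assume "A \<in> sets (distr lborel borel Q)"
  then have [measurable]: "A \<in> sets borel" by simp
  have [measurable]: "Q \<in> borel_measurable borel" by (rule borel_measurable_orthogonal[OF Q])
  have "emeasure (distr lborel borel Q) A = (\<integral>\<^sup>+x. indicator A x \<partial>distr lborel borel Q)"
    by simp
  also have "\<dots> = (\<integral>\<^sup>+x. indicator A (Q x) \<partial>lborel)"
    by (subst nn_integral_distr) auto
  also have "\<dots> = emeasure lborel A"
    by (subst nn_integral_lborel_orthogonal[OF Q]) auto
  finally show "emeasure (distr lborel borel Q) A = emeasure lborel A" .
qed simp

lemma
  fixes f :: "'a::euclidean_space \<Rightarrow> 'b::{banach, second_countable_topology}"
    and Q :: "'a \<Rightarrow> 'a"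
  assumes Q: "orthogonal_transformation Q" and [measurable]: "f \<in> borel_measurable borel"
  shows integral_lborel_orthogonal: "(LINT x|lborel. f (Q x)) = (LINT x|lborel. f x)"
    and integrable_lborel_orthogonal: "integrable lborel (\<lambda>x. f (Q x)) \<longleftrightarrow> integrable lborel f"
proof -
  have [measurable]: "Q \<in> lborel \<rightarrow>\<^sub>M borel"
    using borel_measurable_orthogonal[OF Q] by simp
  show "(LINT x|lborel. f (Q x)) = (LINT x|lborel. f x)"
    using integral_distr[of Q lborel borel f] by (simp add: lborel_distr_orthogonal[OF Q])
  show "integrable lborel (\<lambda>x. f (Q x)) \<longleftrightarrow> integrable lborel f"
    using integrable_distr_eq[of Q lborel borel f] by (simp add: lborel_distr_orthogonal[OF Q])
qed

lemma
  fixes f :: "'a::euclidean_space \<Rightarrow> 'b::{banach, second_countable_topology}"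
  assumes c: "c \<noteq> 0" and [measurable]: "f \<in> borel_measurable borel"
  shows integral_lborel_affine: "(LINT x|lborel. f x) = \<bar>c\<bar> ^ DIM('a) *\<^sub>R (LINT x|lborel. f (t + c *\<^sub>R x))"
    and integrable_lborel_affine: "integrable lborel (\<lambda>x. f (t + c *\<^sub>R x)) \<longleftrightarrow> integrable lborel f"
proof -
  show "(LINT x|lborel. f x) = \<bar>c\<bar> ^ DIM('a) *\<^sub>R (LINT x|lborel. f (t + c *\<^sub>R x))"
    by (subst lborel_affine[OF c, of t])
      (simp add: integral_density integral_distr ennreal_power)
  have "integrable lborel (\<lambda>x. \<bar>c\<bar> ^ DIM('a) *\<^sub>R f (t + c *\<^sub>R x)) \<longleftrightarrow> integrable lborel f"
    by (subst (2) lborel_affine[OF c, of t])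
      (simp add: integrable_density integrable_distr_eq ennreal_power)
  moreover have "integrable lborel (\<lambda>x. \<bar>c\<bar> ^ DIM('a) *\<^sub>R f (t + c *\<^sub>R x)) \<longleftrightarrow>
      integrable lborel (\<lambda>x. f (t + c *\<^sub>R x))"
    using c integrable_scaleR_right[of "inverse (\<bar>c\<bar> ^ DIM('a))" lborel
        "\<lambda>x. \<bar>c\<bar> ^ DIM('a) *\<^sub>R f (t + c *\<^sub>R x)"] by auto
  ultimately show "integrable lborel (\<lambda>x. f (t + c *\<^sub>R x)) \<longleftrightarrow> integrable lborel f"
    by simp
qed

lemma AE_orthogonal:
  fixes Q :: "'a::euclidean_space \<Rightarrow> 'a"
  assumes Q: "orthogonal_transformation Q" and P: "AE x in lborel. P x"
  shows "AE x in lborel. P (Q x)"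
proof (rule AE_distrD[of Q lborel borel P])
  show "Q \<in> lborel \<rightarrow>\<^sub>M borel"
    using borel_measurable_orthogonal[OF Q] by simp
  show "AE x in distr lborel borel Q. P x"
    unfolding lborel_distr_orthogonal[OF Q] by (rule P)
qed

section \<open>Limits and equality almost everywhere\<close>

text \<open>
  The set where the functions differ is open, and a nonempty open set is not a null set.
\<close>

lemma continuous_AE_eq_on:
  fixes f g :: "'a::euclidean_space \<Rightarrow> 'b::real_normed_vector"
  assumes S: "open S" and f: "continuous_on S f" and g: "continuous_on S g"
    and eq: "AE x in lborel. x \<in> S \<longrightarrow> f x = g x" and x: "x \<in> S"
  shows "f x = g x"
proof (rule ccontr)
  assume ne: "f x \<noteq> g x"
  let ?U = "{x \<in> S. f x - g x \<in> - {0}}"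
  have op: "open ?U"
    using continuous_openin_preimage_gen[OF continuous_on_diff[OF f g], of "- {0}"] S
    by (auto simp: Int_def vimage_def openin_open_eq)
  from eq obtain N where N: "{x \<in> space lborel. \<not> (x \<in> S \<longrightarrow> f x = g x)} \<subseteq> N" "N \<in> null_sets lborel"
    by (auto elim: AE_E simp: null_sets_def)
  have "?U \<in> null_sets lborel"
    using N(1) op by (intro null_sets_subset[OF N(2)]) auto
  then have "negligible ?U"
    by (simp add: negligible_iff_null_sets null_sets_completionI)
  moreover have "?U \<noteq> {}" using ne x by auto
  ultimately show False using open_not_negligible[OF op] by blast
qed

corollary continuous_AE_eq:
  fixes f g :: "'a::euclidean_space \<Rightarrow> 'b::real_normed_vector"
  assumes f: "continuous_on UNIV f" and g: "continuous_on UNIV g" and eq: "AE x in lborel. f x = g x"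
  shows "f = g"
proof
  show "f x = g x" for x
    by (rule continuous_AE_eq_on[OF open_UNIV f g]) (use eq in auto)
qed

lemma continuous_nonneg_of_AE:
  fixes f :: "'a::euclidean_space \<Rightarrow> real"
  assumes S: "open S" and f: "continuous_on UNIV f" and AE: "AE x in lborel. x \<in> S \<longrightarrow> 0 \<le> f x" and x: "x \<in> S"
  shows "0 \<le> f x"
proof -
  have "f x = max 0 (f x)"
  proof (rule continuous_AE_eq_on[OF S _ _ _ x])
    show "continuous_on S f" "continuous_on S (\<lambda>x. max 0 (f x))"
      using f by (auto intro!: continuous_intros intro: continuous_on_subset)
    show "AE x in lborel. x \<in> S \<longrightarrow> f x = max 0 (f x)"
      using AE by eventually_elim auto
  qed
  then show ?thesis by linarith
qed

lemma Fatou_integral_le: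
  fixes u :: "nat \<Rightarrow> 'a \<Rightarrow> real"
  assumes int: "\<And>k. integrable M (u k)" and nonneg: "\<And>k x. 0 \<le> u k x"
    and bound: "\<And>k. (LINT x|M. u k x) \<le> c"
    and v: "v \<in> borel_measurable M" and lim: "AE x in M. (\<lambda>k. u k x) \<longlonglongrightarrow> v x"
  shows "integrable M v" and "(LINT x|M. v x) \<le> c"
proof -
  have [measurable]: "u k \<in> borel_measurable M" for k using int by simp
  have "0 \<le> (LINT x|M. u 0 x)" using nonneg by (intro integral_nonneg_AE) simp
  then have c: "0 \<le> c" using bound[of 0] by linarith
  have v_nonneg: "AE x in M. 0 \<le> v x"
    using lim by eventually_elim (rule LIMSEQ_le_const, auto simp: nonneg)
  have "(\<integral>\<^sup>+x. ennreal (v x) \<partial>M) = (\<integral>\<^sup>+x. liminf (\<lambda>k. ennreal (u k x)) \<partial>M)"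
  proof (rule nn_integral_cong_AE)
    show "AE x in M. ennreal (v x) = liminf (\<lambda>k. ennreal (u k x))"
      using lim by eventually_elim (metis lim_imp_Liminf sequentially_bot tendsto_ennrealI)
  qed
  also have "\<dots> \<le> liminf (\<lambda>k. \<integral>\<^sup>+x. ennreal (u k x) \<partial>M)"
    by (rule nn_integral_liminf) simp
  also have "\<dots> \<le> ennreal c"
    using int nonneg bound
    by (intro Liminf_le always_eventually allI)
      (auto simp: nn_integral_eq_integral simp del: ennreal_le_iff ennreal_le_iff2 intro!: ennreal_leI)
  finally have le: "(\<integral>\<^sup>+x. ennreal (v x) \<partial>M) \<le> ennreal c" .
  then show "integrable M v"
    using v v_nonneg by (intro integrableI_nonneg) (auto simp: top_unique less_top[symmetric])
  from nn_integral_eq_integral[OF this v_nonneg] le c show "(LINT x|M. v x) \<le> c"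
    by simp
qed

text \<open>
  Indicators of closed sets are decreasing limits of continuous functions, and the closed sets
  generate the Borel sets, so the integral of \<open>h\<close> over every Borel set vanishes.
\<close>

lemma AE_zero_of_continuous_tests:
  fixes h :: "'a::euclidean_space \<Rightarrow> real"
  assumes h: "integrable lborel h"
    and test: "\<And>\<psi>. continuous_on UNIV \<psi> \<Longrightarrow> (\<And>x. 0 \<le> \<psi> x \<and> \<psi> x \<le> 1) \<Longrightarrow> (LINT x|lborel. h x * \<psi> x) = 0"
  shows "AE x in lborel. h x = 0"
proof -
  have [measurable]: "h \<in> borel_measurable borel" using borel_measurable_integrable[OF h] by simp
  have total: "(LINT x|lborel. h x) = 0"
    using test[of "\<lambda>_. 1"] by simp
  \<comment> \<open>approximate the indicator of \<open>F\<close> by continuous functions that are 1 on \<open>F\<close> and decay with slope \<open>k\<close>\<close>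
  have closed: "(LINT x|lborel. indicator F x * h x) = 0" if F: "closed F" for F
  proof (cases "F = {}")
    case False
    define \<psi> where "\<psi> k x = max 0 (1 - real k * infdist x F)" for k x
    have \<psi>_cont: "continuous_on UNIV (\<psi> k)" for k
      unfolding \<psi>_def by (intro continuous_intros)
    have [measurable]: "\<psi> k \<in> borel_measurable borel" for k
      by (rule borel_measurable_continuous_onI[OF \<psi>_cont])
    have \<psi>_bd: "0 \<le> \<psi> k x \<and> \<psi> k x \<le> 1" for k x
      unfolding \<psi>_def using infdist_nonneg[of x F] by auto
    have [measurable]: "F \<in> sets borel" using F by simp
    have "(\<lambda>k. LINT x|lborel. h x * \<psi> k x) \<longlonglongrightarrow> (LINT x|lborel. h x * indicator F x)"
    proof (rule integral_dominated_convergence[where w="\<lambda>x. norm (h x)"])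
      show "AE x in lborel. (\<lambda>k. h x * \<psi> k x) \<longlonglongrightarrow> h x * indicator F x"
      proof (intro always_eventually allI tendsto_mult tendsto_const)
        fix x
        show "(\<lambda>k. \<psi> k x) \<longlonglongrightarrow> indicator F x"
        proof (cases "x \<in> F")
          case True
          then show ?thesis by (simp add: \<psi>_def)
        next
          case out: False
          then have pos: "infdist x F > 0"
            using F False infdist_nonneg[of x F] in_closed_iff_infdist_zero[of F x] by linarith
          obtain N where N: "1 / infdist x F < real N" using reals_Archimedean2 by blast
          have "\<psi> k x = 0" if "k \<ge> N" for k
          proof -
            have "1 / infdist x F < real k" using N that by linarith
            then show ?thesis using pos by (simp add: \<psi>_def field_simps)
          qed
          then have "eventually (\<lambda>k. \<psi> k x = 0) sequentially"
            by (auto simp: eventually_sequentially)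
          then show ?thesis using out by (simp add: tendsto_eventually)
        qed
      qed
      show "AE x in lborel. norm (h x * \<psi> k x) \<le> norm (h x)" for k
        using \<psi>_bd by (intro always_eventually allI) (simp add: abs_mult mult_left_le)
    qed (use h in auto)
    then show ?thesis
      using test[OF \<psi>_cont \<psi>_bd] by (simp add: LIMSEQ_const_iff mult.commute)
  qed simp
  have all: "(LINT x|lborel. indicator A x * h x) = 0" if "A \<in> sets borel" for A
  proof -
    have sigma: "A \<in> sigma_sets UNIV (Collect closed)"
      using that by (simp add: borel_eq_closed)
    have stable: "Int_stable (Collect closed :: 'a set set)"
      by (auto simp: Int_stable_def)
    show ?thesis
      using stable subset_UNIV[of "Collect closed :: 'a set set", folded Pow_UNIV] sigma
    proof (induct rule: sigma_sets_induct_disjoint)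
      case (basic A)
      then show ?case using closed by simp
    next
      case (compl A)
      then have [measurable]: "A \<in> sets borel" by (simp add: borel_eq_closed)
      have "(LINT x|lborel. indicator (UNIV - A) x * h x) = (LINT x|lborel. h x - indicator A x * h x)"
        by (intro Bochner_Integration.integral_cong refl) (simp add: indicator_def)
      also have "\<dots> = 0"
        using h compl integrable_mult_indicator[of A lborel h] total
        by (subst Bochner_Integration.integral_diff) auto
      finally show ?case .
    next
      case (union A)
      then have [measurable]: "A i \<in> sets borel" for i
        by (auto simp: borel_eq_closed)
      have int: "set_integrable lborel B h" if "B \<in> sets borel" for B
        unfolding set_integrable_def using that h by (intro integrable_mult_indicator) auto
      have "set_lebesgue_integral lborel (\<Union>i. A i) h = (\<Sum>i. set_lebesgue_integral lborel (A i) h)"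
        using union(1) by (intro lebesgue_integral_countable_add int) (auto simp: disjoint_family_on_def)
      then show ?case using union by (simp add: set_lebesgue_integral_def)
    qed simp
  qed
  show ?thesis
    by (rule density_unique_real[of lborel h "\<lambda>_. 0"])
      (use h all in \<open>auto simp: set_lebesgue_integral_def\<close>)
qed

section \<open>The Fourier transform of integrable functions\<close>

lemma fourier_eq_cis:
  "fourier f y = (LINT x|lborel. f x * cis (- (2 * pi * (x \<bullet> y))))"
  by (simp add: fourier_def cis_conv_exp mult_ac)

lemma integrable_mult_cis:
  fixes f :: "'a \<Rightarrow> complex"
  assumes f: "integrable M f" and w: "w \<in> borel_measurable M"
  shows "integrable M (\<lambda>x. f x * cis (w x))"
proof -
  have cis: "cis \<in> borel_measurable borel"
    by (intro borel_measurable_continuous_onI continuous_intros)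
  have "(\<lambda>x. f x * cis (w x)) \<in> borel_measurable M"
    using measurable_compose[OF w cis] borel_measurable_integrable[OF f] by (intro borel_measurable_times)
  then show ?thesis
    by (rule Bochner_Integration.integrable_bound[OF f]) (simp add: norm_mult)
qed

lemma integrable_fourier_integrand:
  "integrable lborel f \<Longrightarrow> integrable lborel (\<lambda>x. f x * cis (- (2 * pi * (x \<bullet> y))))"
  by (rule integrable_mult_cis) auto

lemma norm_fourier_le: "norm (fourier f y) \<le> (LINT x|lborel. norm (f x))"
proof -
  have "norm (fourier f y) \<le> (LINT x|lborel. norm (f x * cis (- (2 * pi * (x \<bullet> y)))))"
    unfolding fourier_eq_cis by (rule integral_norm_bound)
  then show ?thesis by (simp add: norm_mult)
qed

lemma continuous_on_fourier:
  assumes f: "integrable lborel f"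
  shows "continuous_on UNIV (fourier f)"
proof -
  have [measurable]: "f \<in> borel_measurable borel" using borel_measurable_integrable[OF f] by simp
  have "(\<lambda>k. fourier f (u k)) \<longlonglongrightarrow> fourier f a" if "u \<longlonglongrightarrow> a" for u a
    unfolding fourier_eq_cis
  proof (rule integral_dominated_convergence[where w="\<lambda>x. norm (f x)"])
    show "AE x in lborel. (\<lambda>k. f x * cis (- (2 * pi * (x \<bullet> u k)))) \<longlonglongrightarrow> f x * cis (- (2 * pi * (x \<bullet> a)))"
      using that by (intro always_eventually allI tendsto_intros tendsto_cis)
  qed (use f integrable_fourier_integrand[OF f] in \<open>auto simp: norm_mult dest: borel_measurable_integrable\<close>)
  then show ?thesis
    by (auto simp: continuous_on_sequentially o_def)
qed

lemma borel_measurable_fourier: "integrable lborel f \<Longrightarrow> fourier f \<in> borel_measurable borel"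
  by (intro borel_measurable_continuous_onI continuous_on_fourier)

lemma fourier_minus:
  fixes g :: "real ^ 'n \<Rightarrow> real"
  shows "fourier (\<lambda>x. complex_of_real (g x)) (- y) = cnj (fourier (\<lambda>x. complex_of_real (g x)) y)"
  unfolding fourier_eq_cis by (simp add: cis_cnj flip: Bochner_Integration.integral_cnj)

lemma fourier_add:
  assumes "integrable lborel f" "integrable lborel g"
  shows "fourier (\<lambda>x. f x + g x) y = fourier f y + fourier g y"
  unfolding fourier_eq_cis
  using assms[THEN integrable_fourier_integrand] by (simp add: distrib_right)

lemma fourier_cmult: "fourier (\<lambda>x. c * f x) y = c * fourier f y"
  unfolding fourier_eq_cis by (simp add: mult.assoc)

lemma fourier_cong_AE:
  fixes f g :: "real ^ 'n \<Rightarrow> complex"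
  assumes "AE x in lborel. f x = g x" "f \<in> borel_measurable borel" "g \<in> borel_measurable borel"
  shows "fourier f = fourier g"
proof
  fix y :: "real ^ 'n"
  have [measurable]: "(\<lambda>x. cis (- (2 * pi * (x \<bullet> y)))) \<in> borel_measurable borel"
    by (intro borel_measurable_continuous_onI continuous_intros)
  show "fourier f y = fourier g y"
    unfolding fourier_eq_cis using assms by (intro integral_cong_AE) auto
qed

lemma fourier_orthogonal:
  fixes Q :: "real ^ 'n \<Rightarrow> real ^ 'n"
  assumes Q: "orthogonal_transformation Q" and [measurable]: "f \<in> borel_measurable borel"
  shows "fourier (\<lambda>x. f (Q x)) y = fourier f (Q y)"
proof -
  have [measurable]: "(\<lambda>x. cis (- (2 * pi * (x \<bullet> Q y)))) \<in> borel_measurable borel"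
    by (intro borel_measurable_continuous_onI continuous_intros)
  have "Q x \<bullet> Q y = x \<bullet> y" for x
    using Q by (simp add: orthogonal_transformation_def)
  then show ?thesis
    unfolding fourier_eq_cis
    using integral_lborel_orthogonal[OF Q, of "\<lambda>x. f x * cis (- (2 * pi * (x \<bullet> Q y)))"] by simp
qed

lemma fourier_scale:
  fixes f :: "real ^ 'n \<Rightarrow> complex"
  assumes c: "c > 0" and [measurable]: "f \<in> borel_measurable borel"
  shows "fourier (\<lambda>x. f (c *\<^sub>R x)) y = of_real (1 / c ^ CARD('n)) * fourier f (y /\<^sub>R c)"
proof -
  let ?h = "\<lambda>x. f x * cis (- (2 * pi * (x \<bullet> (y /\<^sub>R c))))"
  have "(\<lambda>x. cis (- (2 * pi * (x \<bullet> (y /\<^sub>R c))))) \<in> borel_measurable borel"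
    by (intro borel_measurable_continuous_onI continuous_intros)
  then have h: "?h \<in> borel_measurable borel"
    by (intro borel_measurable_times assms)
  have "(LINT x|lborel. ?h (0 + c *\<^sub>R x)) = fourier (\<lambda>x. f (c *\<^sub>R x)) y"
    unfolding fourier_eq_cis
  proof (intro Bochner_Integration.integral_cong refl)
    fix x
    have "(c *\<^sub>R x) \<bullet> (y /\<^sub>R c) = x \<bullet> y" using c by simp
    then show "?h (0 + c *\<^sub>R x) = f (c *\<^sub>R x) * cis (- (2 * pi * (x \<bullet> y)))"
      by (simp only: add_0)
  qed
  then have "fourier f (y /\<^sub>R c) = c ^ CARD('n) *\<^sub>R fourier (\<lambda>x. f (c *\<^sub>R x)) y"
    unfolding fourier_eq_cis[of f]
    using integral_lborel_affine[OF _ h, of c 0] c by simp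
  then show ?thesis
    using c by (simp add: scaleR_conv_of_real)
qed

lemma fourier_modulate:
  "fourier (\<lambda>x. cis (2 * pi * (x \<bullet> u)) * f x) y = fourier f (y - u)"
  unfolding fourier_eq_cis
  by (intro Bochner_Integration.integral_cong refl) (simp add: cis_mult[symmetric] cis_divide[symmetric] inner_diff_right right_diff_distrib cis_mult mult_ac)

lemma norm_cis_diff_le: "norm (cis a - cis b) \<le> \<bar>a - b\<bar>"
proof -
  have "cis b * cis (a - b) = cis a"
    unfolding cis_mult by (rule arg_cong[where f=cis]) simp
  then have "cis a - cis b = cis b * (cis (a - b) - 1)"
    by (simp only: right_diff_distrib mult_1_right)
  then have "norm (cis a - cis b) = norm (cis (a - b) - 1)"
    by (simp only: norm_mult norm_cis mult_1_left)
  also have "\<dots> \<le> \<bar>a - b\<bar>"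
  proof -
    have "(\<Sum>k\<le>0. (\<i> * complex_of_real (a - b)) ^ k / fact k) = 1" by simp
    then show ?thesis
      using iexp_approx1[of "a - b" 0] unfolding cis_conv_exp by simp
  qed
  finally show ?thesis .
qed

text \<open>
  This is the source of equicontinuity: the constant depends only on the radius of the support
  and on the \<open>L\<^sup>1\<close> norm.
\<close>

lemma fourier_lipschitz:
  fixes b :: "real ^ 'n \<Rightarrow> complex"
  assumes b: "integrable lborel b" and supp: "\<And>x. norm x > R \<Longrightarrow> b x = 0" and R: "R \<ge> 0"
  shows "norm (fourier b y - fourier b z) \<le> 2 * pi * R * norm (y - z) * (LINT x|lborel. norm (b x))"
proof -
  have "fourier b y - fourier b z =
      (LINT x|lborel. b x * cis (- (2 * pi * (x \<bullet> y))) - b x * cis (- (2 * pi * (x \<bullet> z))))"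
    unfolding fourier_eq_cis using b by (intro Bochner_Integration.integral_diff[symmetric] integrable_fourier_integrand)
  also have "norm \<dots> \<le> (LINT x|lborel. 2 * pi * R * norm (y - z) * norm (b x))"
  proof (rule Bochner_Integration.integral_norm_bound_integral)
    fix x
    show "norm (b x * cis (- (2 * pi * (x \<bullet> y))) - b x * cis (- (2 * pi * (x \<bullet> z)))) \<le> 2 * pi * R * norm (y - z) * norm (b x)"
    proof (cases "norm x > R")
      case False
      have "norm (cis (- (2 * pi * (x \<bullet> y))) - cis (- (2 * pi * (x \<bullet> z)))) \<le> \<bar>- (2 * pi * (x \<bullet> y)) - - (2 * pi * (x \<bullet> z))\<bar>"
        by (rule norm_cis_diff_le)
      also have "- (2 * pi * (x \<bullet> y)) - - (2 * pi * (x \<bullet> z)) = - (2 * pi * (x \<bullet> (y - z)))"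
        by (simp add: inner_diff_right algebra_simps)
      also have "\<bar>- (2 * pi * (x \<bullet> (y - z)))\<bar> = 2 * pi * \<bar>x \<bullet> (y - z)\<bar>" by (simp add: abs_mult)
      also have "\<dots> \<le> 2 * pi * (R * norm (y - z))"
        using Cauchy_Schwarz_ineq2[of x "y - z"] mult_right_mono[of "norm x" R "norm (y - z)"] False
        by (intro mult_left_mono) auto
      finally show ?thesis
        unfolding right_diff_distrib[symmetric] norm_mult
        by (subst mult.commute, intro mult_right_mono) (simp_all only: mult.assoc norm_ge_zero)
    qed (simp add: supp)
  qed (use b in \<open>auto intro!: Bochner_Integration.integrable_diff integrable_fourier_integrand\<close>)
  finally show ?thesis by simp
qed

lemma fourier_multiplication_formula:
  fixes f g :: "real ^ 'n \<Rightarrow> complex"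
  assumes f: "integrable lborel f" and g: "integrable lborel g"
  shows "(LINT y|lborel. fourier f y * g y) = (LINT x|lborel. f x * fourier g x)"
proof -
  have [measurable]: "f \<in> borel_measurable borel" "g \<in> borel_measurable borel"
    using borel_measurable_integrable[OF f] borel_measurable_integrable[OF g] by simp_all
  have [measurable]: "(\<lambda>p::(real^'n) \<times> (real^'n). cis (- (2 * pi * (fst p \<bullet> snd p)))) \<in> borel_measurable (borel \<Otimes>\<^sub>M borel)"
    unfolding borel_prod by (intro borel_measurable_continuous_onI continuous_intros)
  define F where "F x y = f x * g y * cis (- (2 * pi * (x \<bullet> y)))" for x y
  have F_meas: "case_prod F \<in> borel_measurable (lborel \<Otimes>\<^sub>M lborel)"
    unfolding F_def by (auto simp: case_prod_beta' cong: measurable_cong_sets)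
  have int: "integrable (lborel \<Otimes>\<^sub>M lborel) (case_prod F)"
  proof (rule lborel_pair.Fubini_integrable[OF F_meas])
    show "integrable lborel (\<lambda>x. LINT y|lborel. norm (case_prod F (x, y)))"
      unfolding F_def using f by (simp add: norm_mult)
    show "AE x in lborel. integrable lborel (\<lambda>y. case_prod F (x, y))"
      unfolding F_def using g by (auto intro!: integrable_mult_cis)
  qed
  have "(LINT y|lborel. fourier f y * g y) = (LINT y|lborel. LINT x|lborel. F x y)"
    unfolding fourier_eq_cis F_def by (simp add: mult_ac flip: integral_mult_right_zero integral_mult_left_zero)
  also have "\<dots> = (LINT x|lborel. LINT y|lborel. F x y)"
    by (rule lborel_pair.Fubini_integral[OF int])
  also have "\<dots> = (LINT x|lborel. f x * fourier g x)"
    unfolding fourier_eq_cis F_def by (simp add: mult_ac inner_commute flip: integral_mult_right_zero integral_mult_left_zero)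
  finally show ?thesis .
qed

section \<open>The Gaussian\<close>

definition gauss :: "'a::euclidean_space \<Rightarrow> real" where
  "gauss x = exp (- (pi * (norm x)\<^sup>2))"

text \<open>
  The characteristic function of the standard normal distribution, rescaled by \<open>sqrt (2 *
  pi)\<close>.
\<close>

lemma gauss_fourier_real:
  fixes t :: real
  shows "integrable lborel (\<lambda>x. of_real (exp (- (pi * x\<^sup>2))) * cis (- (2 * pi * (x * t))))" (is ?A)
    and "(LINT x|lborel. of_real (exp (- (pi * x\<^sup>2))) * cis (- (2 * pi * (x * t)))) = of_real (exp (- (pi * t\<^sup>2)))" (is ?B)
proof -
  define s where "s = sqrt (2 * pi)"
  have s: "s > 0" "s\<^sup>2 = 2 * pi" by (auto simp: s_def)
  define h where "h x = of_real (std_normal_density x) * iexp (- (s * t) * x)" for x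
  have h_meas [measurable]: "h \<in> borel_measurable borel" unfolding h_def by measurable
  have char: "char std_normal_distribution (- (s * t)) = (LINT x|lborel. h x)"
    unfolding char_def h_def by (subst integral_density) (auto simp: scaleR_conv_of_real)
  have h_int: "integrable lborel h"
  proof (rule Bochner_Integration.integrable_bound)
    show "integrable lborel std_normal_density" by simp
  qed (auto simp: h_def norm_mult)
  have sub: "of_real s * h (0 + s * x) = of_real (exp (- (pi * x\<^sup>2))) * cis (- (2 * pi * (x * t)))" for x
  proof -
    have "s * std_normal_density (s * x) = exp (- (pi * x\<^sup>2))"
      using s by (simp add: std_normal_density_def s_def[symmetric] power_mult_distrib)
    moreover have "iexp (- (s * t) * (s * x)) = cis (- (2 * pi * (x * t)))"
    proof -
      have "- (s * t) * (s * x) = - (2 * pi * (x * t))"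
        using s(2) by (simp add: power2_eq_square mult_ac)
      then show ?thesis by (simp only: cis_conv_exp)
    qed
    ultimately show ?thesis unfolding h_def by (simp flip: mult.assoc of_real_mult)
  qed
  have "integrable lborel (\<lambda>x. of_real s * h (0 + s * x))"
    using h_int s by (intro integrable_mult_right lborel_integrable_real_affine) auto
  then show ?A unfolding sub .
  have "(LINT x|lborel. of_real s * h (0 + s * x)) = (LINT x|lborel. h x)"
    using s by (subst lborel_integral_real_affine[of s h 0]) (auto simp: scaleR_conv_of_real)
  then show ?B
    unfolding sub char[symmetric] char_std_normal_distribution
    using s by (simp add: power_mult_distrib)
qed

lemma integral_lborel_prod:
  fixes h :: "'a::euclidean_space \<Rightarrow> real \<Rightarrow> complex"
  assumes h: "\<And>b. b \<in> Basis \<Longrightarrow> integrable lborel (h b)"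
  shows "integrable lborel (\<lambda>x. \<Prod>b\<in>Basis. h b (x \<bullet> b))" (is ?A)
    and "(LINT x|lborel. (\<Prod>b\<in>Basis. h b (x \<bullet> b))) = (\<Prod>b\<in>Basis. (LINT x|lborel. h b x))" (is ?B)
proof -
  interpret product_sigma_finite "\<lambda>_::'a. lborel :: real measure" by standard
  let ?P = "\<Pi>\<^sub>M b\<in>(Basis::'a set). (lborel :: real measure)"
  let ?T = "\<lambda>f. \<Sum>b\<in>(Basis::'a set). f b *\<^sub>R b"
  have [measurable]: "h b \<in> borel_measurable borel" if "b \<in> Basis" for b
    using borel_measurable_integrable[OF h[OF that]] by simp
  have meas: "(\<lambda>x. \<Prod>b\<in>Basis. h b (x \<bullet> b)) \<in> borel_measurable borel"
    by measurable
  have T: "?T \<in> measurable ?P borel" by measurable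
  have eq: "(\<Prod>b\<in>Basis. h b (?T f \<bullet> b)) = (\<Prod>b\<in>Basis. h b (f b))" for f
    by (intro prod.cong refl) simp
  show ?A
    using product_integrable_prod[OF finite_Basis, of h] h
    by (subst lborel_eq, subst integrable_distr_eq[OF T]) (auto simp: eq meas)
  show ?B
    using product_integral_prod[OF finite_Basis, of h] h
    by (subst lborel_eq, subst integral_distr[OF T]) (auto simp: eq meas)
qed

lemma gauss_eq_prod:
  fixes x y :: "'a::euclidean_space"
  shows "of_real (gauss x) * cis (- (2 * pi * (x \<bullet> y))) =
    (\<Prod>b\<in>Basis. of_real (exp (- (pi * (x \<bullet> b)\<^sup>2))) * cis (- (2 * pi * ((x \<bullet> b) * (y \<bullet> b)))))"
proof -
  have "of_real (gauss x) * cis (- (2 * pi * (x \<bullet> y))) =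
      exp (of_real (- (pi * (x \<bullet> x))) + \<i> * of_real (- (2 * pi * (x \<bullet> y))))"
    unfolding exp_add by (simp only: gauss_def cis_conv_exp exp_of_real power2_norm_eq_inner)
  also have "of_real (- (pi * (x \<bullet> x))) + \<i> * of_real (- (2 * pi * (x \<bullet> y))) =
      (\<Sum>b\<in>Basis. of_real (- (pi * (x \<bullet> b)\<^sup>2)) + \<i> * of_real (- (2 * pi * ((x \<bullet> b) * (y \<bullet> b)))))"
    by (subst (1 2) euclidean_inner)
      (simp add: sum.distrib sum_distrib_left power2_eq_square sum_negf sum_subtractf)
  also have "exp \<dots> = (\<Prod>b\<in>Basis. exp (of_real (- (pi * (x \<bullet> b)\<^sup>2)) + \<i> * of_real (- (2 * pi * ((x \<bullet> b) * (y \<bullet> b))))))"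
    by (rule exp_sum) simp
  finally show ?thesis
    unfolding exp_add by (simp only: cis_conv_exp exp_of_real)
qed

lemma gauss_pos: "gauss x > 0" and gauss_le_1: "gauss x \<le> 1" and gauss_0 [simp]: "gauss 0 = 1"
  by (auto simp: gauss_def)

lemma continuous_on_gauss [continuous_intros]:
  "continuous_on A f \<Longrightarrow> continuous_on A (\<lambda>x. gauss (f x))"
  unfolding gauss_def by (intro continuous_intros)

lemma borel_measurable_gauss [measurable]: "gauss \<in> borel_measurable borel"
  by (intro borel_measurable_continuous_onI continuous_intros)

lemma integrable_gauss: "integrable lborel (gauss :: 'a::euclidean_space \<Rightarrow> real)"
proof -
  have "integrable lborel (\<lambda>x::'a. of_real (gauss x) * cis (- (2 * pi * (x \<bullet> 0))))"
    unfolding gauss_eq_prod by (intro integral_lborel_prod gauss_fourier_real)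
  then have "integrable lborel (\<lambda>x::'a. complex_of_real (gauss x))" by simp
  then show ?thesis using integrable_Re[of lborel] by fastforce
qed

lemma gauss_fourier:
  "(LINT x|lborel. of_real (gauss x) * cis (- (2 * pi * (x \<bullet> y)))) = of_real (gauss (y::'a::euclidean_space))"
proof -
  have "(LINT x|lborel. of_real (gauss x) * cis (- (2 * pi * (x \<bullet> y)))) =
     (\<Prod>b\<in>Basis. complex_of_real (exp (- (pi * (y \<bullet> b)\<^sup>2))))"
    unfolding gauss_eq_prod
    by (subst integral_lborel_prod) (auto intro!: gauss_fourier_real prod.cong simp del: of_real_exp)
  also have "\<dots> = of_real (gauss y)"
    using gauss_eq_prod[of y 0] by simp
  finally show ?thesis .
qed

lemma integral_gauss: "(LINT x|lborel. gauss (x::'a::euclidean_space)) = 1"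
proof -
  have "complex_of_real (LINT x|lborel. gauss (x::'a)) = complex_of_real 1"
    using gauss_fourier[of "0::'a"] by simp
  then show ?thesis by (simp only: of_real_eq_iff)
qed

lemma fourier_gauss: "fourier (\<lambda>x. complex_of_real (gauss x)) y = complex_of_real (gauss y)"
  unfolding fourier_eq_cis by (rule gauss_fourier)

section \<open>Gaussian mollification and Fourier inversion\<close>

text \<open>
  The Fourier transform of \<open>\<lambda>x. gauss (\<epsilon> *\<^sub>R x)\<close>, an
  approximate identity as \<open>\<epsilon>\<close> tends to 0.
\<close>

definition mollifier :: "real \<Rightarrow> 'a::euclidean_space \<Rightarrow> real" where
  "mollifier \<epsilon> x = gauss (x /\<^sub>R \<epsilon>) / \<epsilon> ^ DIM('a)"

lemma continuous_on_mollifier [continuous_intros]: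
  "continuous_on A f \<Longrightarrow> continuous_on A (\<lambda>x. mollifier \<epsilon> (f x))"
  unfolding mollifier_def divide_inverse by (intro continuous_intros)

lemma borel_measurable_mollifier [measurable]: "mollifier \<epsilon> \<in> borel_measurable borel"
  by (intro borel_measurable_continuous_onI continuous_intros)

lemma mollifier_pos: "\<epsilon> > 0 \<Longrightarrow> mollifier \<epsilon> x > 0"
  by (simp add: mollifier_def gauss_pos)

lemma mollifier_le: "\<epsilon> > 0 \<Longrightarrow> mollifier \<epsilon> (x::'a::euclidean_space) \<le> 1 / \<epsilon> ^ DIM('a)"
  unfolding mollifier_def by (intro divide_right_mono gauss_le_1) simp

lemma integral_mollifier_mult:
  fixes \<psi> :: "'a::euclidean_space \<Rightarrow> real"
  assumes \<epsilon>: "\<epsilon> > 0" and [measurable]: "\<psi> \<in> borel_measurable borel"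
  shows "(LINT u|lborel. mollifier \<epsilon> (x - u) * \<psi> u) = (LINT v|lborel. gauss v * \<psi> (x - \<epsilon> *\<^sub>R v))"
proof -
  have "(LINT u|lborel. mollifier \<epsilon> (x - u) * \<psi> u) =
      \<epsilon> ^ DIM('a) *\<^sub>R (LINT v|lborel. mollifier \<epsilon> (x - (x + (- \<epsilon>) *\<^sub>R v)) * \<psi> (x + (- \<epsilon>) *\<^sub>R v))"
    using \<epsilon> integral_lborel_affine[of "- \<epsilon>" "\<lambda>u. mollifier \<epsilon> (x - u) * \<psi> u" x] by simp
  also have "\<dots> = (LINT v|lborel. \<epsilon> ^ DIM('a) *\<^sub>R (mollifier \<epsilon> (x - (x + (- \<epsilon>) *\<^sub>R v)) * \<psi> (x + (- \<epsilon>) *\<^sub>R v)))"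
    by (rule integral_scaleR_right[symmetric])
  also have "\<dots> = (LINT v|lborel. gauss v * \<psi> (x - \<epsilon> *\<^sub>R v))"
    using \<epsilon> by (intro Bochner_Integration.integral_cong refl) (simp add: mollifier_def)
  finally show ?thesis .
qed

lemma
  fixes \<psi> :: "'a::euclidean_space \<Rightarrow> real"
  assumes \<psi>: "continuous_on UNIV \<psi>" and B: "\<And>x. \<bar>\<psi> x\<bar> \<le> B"
  shows mollified_bounded: "\<epsilon> > 0 \<Longrightarrow> \<bar>LINT u|lborel. mollifier \<epsilon> (x - u) * \<psi> u\<bar> \<le> B"
    and mollified_tendsto:
      "(\<lambda>k. LINT u|lborel. mollifier (1 / real (Suc k)) (x - u) * \<psi> u) \<longlonglongrightarrow> \<psi> x"
proof -
  have [measurable]: "\<psi> \<in> borel_measurable borel" using \<psi> by (rule borel_measurable_continuous_onI)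
  have int: "integrable lborel (\<lambda>v. B * gauss (v::'a))" by (intro integrable_mult_right integrable_gauss)
  have bd: "norm (gauss v * \<psi> z) \<le> B * gauss v" for v z :: 'a
    using B[of z] gauss_pos[of v] by (simp add: abs_mult mult.commute)
  {
    assume \<epsilon>: "\<epsilon> > 0"
    have "norm (LINT v|lborel. gauss v * \<psi> (x - \<epsilon> *\<^sub>R v)) \<le> (LINT v|lborel. B * gauss (v::'a))"
    proof (rule Bochner_Integration.integral_norm_bound_integral[OF _ int bd])
      show "integrable lborel (\<lambda>v. gauss v * \<psi> (x - \<epsilon> *\<^sub>R v))"
      proof (rule Bochner_Integration.integrable_bound[OF int])
        have "norm (gauss v * \<psi> z) \<le> norm (B * gauss v)" for v z :: 'a
          using bd[of v z] by simp
        then show "AE v in lborel. norm (gauss v * \<psi> (x - \<epsilon> *\<^sub>R v)) \<le> norm (B * gauss v)"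
          by (intro always_eventually allI)
      qed simp
    qed
    then show "\<bar>LINT u|lborel. mollifier \<epsilon> (x - u) * \<psi> u\<bar> \<le> B"
      using \<epsilon> by (simp add: integral_mollifier_mult integral_gauss)
  }
  have "(\<lambda>k. LINT v|lborel. gauss v * \<psi> (x - (1 / real (Suc k)) *\<^sub>R v)) \<longlonglongrightarrow> (LINT v|lborel. gauss (v::'a) * \<psi> x)"
  proof (rule integral_dominated_convergence[where w="\<lambda>v::'a. B * gauss v"])
    show "AE v in lborel. (\<lambda>k. gauss v * \<psi> (x - (1 / real (Suc k)) *\<^sub>R v)) \<longlonglongrightarrow> gauss v * \<psi> x"
    proof (intro always_eventually allI tendsto_mult tendsto_const)
      fix v
      have "(\<lambda>k. x - (1 / real (Suc k)) *\<^sub>R v) \<longlonglongrightarrow> x - 0 *\<^sub>R v"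
        using lim_inverse_n' by (intro tendsto_intros) (rule LIMSEQ_Suc)
      then show "(\<lambda>k. \<psi> (x - (1 / real (Suc k)) *\<^sub>R v)) \<longlonglongrightarrow> \<psi> x"
        using \<psi> by (intro continuous_on_tendsto_compose[of UNIV \<psi>]) auto
    qed
  qed (use int bd in auto)
  then show "(\<lambda>k. LINT u|lborel. mollifier (1 / real (Suc k)) (x - u) * \<psi> u) \<longlonglongrightarrow> \<psi> x"
    by (simp add: integral_mollifier_mult integral_gauss del: of_nat_Suc)
qed

text \<open>
  The mollified functions converge to \<open>f\<close> weakly, that is when integrated against a
  bounded continuous integrable function, because the symmetric kernel can be moved to the test
  function. If they also converge boundedly to \<open>g\<close>, then \<open>f\<close> and
  \<open>g\<close> have the same integrals against all such functions. Both Fourier inversion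
  and the self-duality of the limit are instances.
\<close>

lemma AE_eq_of_mollified_tendsto:
  fixes f g :: "'a::euclidean_space \<Rightarrow> real"
  assumes f: "integrable lborel f" and [measurable]: "g \<in> borel_measurable borel"
    and bound: "\<And>k u. \<bar>LINT x|lborel. f x * mollifier (1 / real (Suc k)) (x - u)\<bar> \<le> C"
    and lim: "\<And>u. (\<lambda>k. LINT x|lborel. f x * mollifier (1 / real (Suc k)) (x - u)) \<longlonglongrightarrow> g u"
  shows "AE x in lborel. f x = g x"
proof -
  have [measurable]: "f \<in> borel_measurable borel" using borel_measurable_integrable[OF f] by simp
  have g_bound: "\<bar>g u\<bar> \<le> C" for u
    by (rule LIMSEQ_le_const2[OF tendsto_rabs[OF lim[of u]]]) (use bound in blast)
  \<comment> \<open>\<open>g\<close> is bounded but not known to be integrable, so the two functions are compared after weighting by \<open>gauss\<close>\<close>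
  have fg: "integrable lborel (\<lambda>x. f x * gauss x)" "integrable lborel (\<lambda>x. g x * gauss x)"
  proof -
    have "norm (f x * gauss x) \<le> norm (f x)" for x
      using gauss_pos[of x] gauss_le_1[of x] by (simp add: abs_mult mult_left_le)
    then show "integrable lborel (\<lambda>x. f x * gauss x)"
      by (intro Bochner_Integration.integrable_bound[OF f]) auto
    have int: "integrable lborel (\<lambda>x. C * gauss (x::'a))"
      by (intro integrable_mult_right integrable_gauss)
    have "norm (g x * gauss x) \<le> norm (C * gauss x)" for x
      using gauss_pos[of x] g_bound[of x] by (simp add: abs_mult mult_right_mono)
    then show "integrable lborel (\<lambda>x. g x * gauss x)"
      by (intro Bochner_Integration.integrable_bound[OF int]) auto
  qed
  have test: "(LINT x|lborel. f x * \<psi> x) = (LINT x|lborel. g x * \<psi> x)"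
    if \<psi>: "continuous_on UNIV \<psi>" "integrable lborel \<psi>" and B: "\<And>x. \<bar>\<psi> x\<bar> \<le> B" for \<psi> B
  proof -
    have [measurable]: "\<psi> \<in> borel_measurable borel" using \<psi>(1) by (rule borel_measurable_continuous_onI)
    let ?h = "\<lambda>k. mollifier (1 / real (Suc k)) :: 'a \<Rightarrow> real"
    have swap: "(LINT u|lborel. \<psi> u * (LINT x|lborel. f x * ?h k (x - u))) =
        (LINT x|lborel. f x * (LINT u|lborel. ?h k (x - u) * \<psi> u))" for k
    proof -
      define F where "F x u = f x * (?h k (x - u) * \<psi> u)" for x u
      have int0: "integrable (lborel \<Otimes>\<^sub>M lborel) (\<lambda>(x, u). f x * \<psi> u)"
      proof (rule lborel_pair.Fubini_integrable)
        show "(\<lambda>(x, u). f x * \<psi> u) \<in> borel_measurable (lborel \<Otimes>\<^sub>M lborel)"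
          by measurable
      qed (use f \<psi>(2) in \<open>auto simp add: abs_mult\<close>)
      have "integrable (lborel \<Otimes>\<^sub>M lborel) (\<lambda>p. (1 / (1 / real (Suc k)) ^ DIM('a)) * (\<lambda>(x, u). f x * \<psi> u) p)"
        using int0 by (rule integrable_mult_right)
      then have "integrable (lborel \<Otimes>\<^sub>M lborel) (case_prod F)"
      proof (rule Bochner_Integration.integrable_bound)
        show "case_prod F \<in> borel_measurable (lborel \<Otimes>\<^sub>M lborel)"
          unfolding F_def by measurable
        have "norm (F x u) \<le> norm ((1 / (1 / real (Suc k)) ^ DIM('a)) * (f x * \<psi> u))" for x u
        proof -
          have "norm (F x u) = ?h k (x - u) * \<bar>f x * \<psi> u\<bar>"
            unfolding F_def using mollifier_pos[of "1 / real (Suc k)" "x - u"] by (simp add: abs_mult)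
          also have "\<dots> \<le> (1 / (1 / real (Suc k)) ^ DIM('a)) * \<bar>f x * \<psi> u\<bar>"
            by (intro mult_right_mono mollifier_le) auto
          finally show ?thesis by (simp add: abs_mult)
        qed
        then show "AE p in lborel \<Otimes>\<^sub>M lborel. norm (case_prod F p) \<le>
            norm ((1 / (1 / real (Suc k)) ^ DIM('a)) * (\<lambda>(x, u). f x * \<psi> u) p)"
          by (intro always_eventually) auto
      qed
      from lborel_pair.Fubini_integral[OF this] show ?thesis
        unfolding F_def by (simp add: mult_ac flip: integral_mult_right_zero integral_mult_left_zero)
    qed
    have lim_g: "(\<lambda>k. LINT u|lborel. \<psi> u * (LINT x|lborel. f x * ?h k (x - u))) \<longlonglongrightarrow> (LINT u|lborel. \<psi> u * g u)"
    proof (rule integral_dominated_convergence[where w="\<lambda>u. C * norm (\<psi> u)"])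
      show "AE u in lborel. (\<lambda>k. \<psi> u * (LINT x|lborel. f x * ?h k (x - u))) \<longlonglongrightarrow> \<psi> u * g u"
        by (intro always_eventually allI tendsto_mult tendsto_const lim)
      show "AE u in lborel. norm (\<psi> u * (LINT x|lborel. f x * ?h k (x - u))) \<le> C * norm (\<psi> u)" for k
        unfolding real_norm_def abs_mult mult.commute[of "\<bar>\<psi> _\<bar>"]
        by (intro always_eventually allI mult_right_mono bound abs_ge_zero)
    qed (use \<psi> in auto)
    have "(\<lambda>k. LINT x|lborel. f x * (LINT u|lborel. ?h k (x - u) * \<psi> u)) \<longlonglongrightarrow> (LINT x|lborel. f x * \<psi> x)"
    proof (rule integral_dominated_convergence[where w="\<lambda>x. B * norm (f x)"])
      show "AE x in lborel. (\<lambda>k. f x * (LINT u|lborel. ?h k (x - u) * \<psi> u)) \<longlonglongrightarrow> f x * \<psi> x"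
        by (intro always_eventually allI tendsto_mult tendsto_const mollified_tendsto[OF \<psi>(1) B])
      show "AE x in lborel. norm (f x * (LINT u|lborel. ?h k (x - u) * \<psi> u)) \<le> B * norm (f x)" for k
        unfolding real_norm_def abs_mult mult.commute[of "\<bar>f _\<bar>"]
        by (intro always_eventually allI mult_right_mono mollified_bounded[OF \<psi>(1) B] abs_ge_zero) simp
    qed (use f in auto)
    with lim_g show ?thesis
      unfolding swap by (auto dest: LIMSEQ_unique simp: mult.commute)
  qed
  have "AE x in lborel. f x * gauss x - g x * gauss x = 0"
  proof (rule AE_zero_of_continuous_tests)
    show "integrable lborel (\<lambda>x. f x * gauss x - g x * gauss x)"
      using fg by simp
    fix \<psi> :: "'a \<Rightarrow> real"
    assume \<psi>: "continuous_on UNIV \<psi>" "\<And>x. 0 \<le> \<psi> x \<and> \<psi> x \<le> 1"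
    have [measurable]: "\<psi> \<in> borel_measurable borel" using \<psi>(1) by (rule borel_measurable_continuous_onI)
    have \<psi>g: "\<bar>gauss x * \<psi> x\<bar> \<le> gauss x" for x
      using \<psi>(2)[of x] gauss_pos[of x] by (simp add: abs_mult mult_left_le)
    have "(LINT x|lborel. f x * (gauss x * \<psi> x)) = (LINT x|lborel. g x * (gauss x * \<psi> x))"
    proof (rule test)
      show "continuous_on UNIV (\<lambda>x. gauss x * \<psi> x)"
        using \<psi>(1) by (intro continuous_intros)
      show "integrable lborel (\<lambda>x. gauss x * \<psi> x)"
        by (rule Bochner_Integration.integrable_bound[OF integrable_gauss])
          (use \<psi>g in \<open>auto simp: gauss_pos less_imp_le\<close>)
      show "\<bar>gauss x * \<psi> x\<bar> \<le> 1" for x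
        using \<psi>g[of x] gauss_le_1[of x] by linarith
    qed
    moreover have "integrable lborel (\<lambda>x. h x * gauss x * \<psi> x)"
      if "integrable lborel (\<lambda>x. h x * gauss x)" for h
    proof (rule Bochner_Integration.integrable_bound[OF that])
      show "(\<lambda>x. h x * gauss x * \<psi> x) \<in> borel_measurable lborel"
        using borel_measurable_integrable[OF that] by measurable
    qed (use \<psi>(2) in \<open>auto simp: abs_mult mult_left_le\<close>)
    ultimately show "(LINT x|lborel. (f x * gauss x - g x * gauss x) * \<psi> x) = 0"
      using fg by (simp add: left_diff_distrib mult.assoc)
  qed
  then show ?thesis
    by eventually_elim (metis eq_iff_diff_eq_0 gauss_pos less_irrefl mult_cancel_right)
qed

text \<open>
  The multiplication formula for the modulated Gaussian, whose transform is the kernel centred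
  at \<open>u\<close>.
\<close>

lemma mollified_eq_fourier:
  fixes f :: "real ^ 'n \<Rightarrow> real"
  assumes f: "integrable lborel f" and \<epsilon>: "\<epsilon> > 0"
  shows "complex_of_real (LINT x|lborel. f x * mollifier \<epsilon> (x - u)) =
    (LINT x|lborel. fourier (\<lambda>x. complex_of_real (f x)) x * (cis (2 * pi * (x \<bullet> u)) * of_real (gauss (\<epsilon> *\<^sub>R x))))"
proof -
  let ?g = "\<lambda>x. cis (2 * pi * (x \<bullet> u)) * complex_of_real (gauss (\<epsilon> *\<^sub>R x))"
  have "integrable lborel (\<lambda>x::real^'n. gauss (0 + \<epsilon> *\<^sub>R x))"
    using \<epsilon> integrable_gauss by (subst integrable_lborel_affine) auto
  then have "integrable lborel (\<lambda>x. complex_of_real (gauss (\<epsilon> *\<^sub>R x)) * cis (2 * pi * (x \<bullet> u)))"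
    by (intro integrable_mult_cis integrable_of_real) auto
  then have g: "integrable lborel ?g"
    by (simp add: mult.commute)
  have fg: "fourier ?g x = complex_of_real (mollifier \<epsilon> (x - u))" for x
  proof -
    have "fourier ?g x = fourier (\<lambda>x. complex_of_real (gauss (\<epsilon> *\<^sub>R x))) (x - u)"
      by (rule fourier_modulate)
    also have "\<dots> = of_real (1 / \<epsilon> ^ CARD('n)) * fourier (\<lambda>x. complex_of_real (gauss x)) ((x - u) /\<^sub>R \<epsilon>)"
      using \<epsilon> by (intro fourier_scale) auto
    finally show ?thesis
      by (simp add: fourier_gauss mollifier_def)
  qed
  have "complex_of_real (LINT x|lborel. f x * mollifier \<epsilon> (x - u)) =
      (LINT x|lborel. complex_of_real (f x) * fourier ?g x)"
    by (simp add: fg flip: of_real_mult)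
  also have "\<dots> = (LINT x|lborel. fourier (\<lambda>x. complex_of_real (f x)) x * ?g x)"
    using f g by (intro fourier_multiplication_formula[symmetric]) auto
  finally show ?thesis .
qed

lemma gauss_scaled_tendsto_1: "(\<lambda>k. gauss ((1 / real (Suc k)) *\<^sub>R x)) \<longlonglongrightarrow> 1"
proof -
  have "(\<lambda>k. (1 / real (Suc k)) *\<^sub>R x) \<longlonglongrightarrow> 0 *\<^sub>R x"
    using lim_inverse_n' by (intro tendsto_intros) (rule LIMSEQ_Suc)
  then have "(\<lambda>k. gauss ((1 / real (Suc k)) *\<^sub>R x)) \<longlonglongrightarrow> gauss (0 *\<^sub>R x)"
    by (intro continuous_on_tendsto_compose[of UNIV gauss]) (auto intro!: continuous_intros)
  then show ?thesis by simp
qed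

lemma fourier_inversion_AE:
  fixes f :: "real ^ 'n \<Rightarrow> real"
  assumes f: "integrable lborel f"
    and F: "integrable lborel (fourier (\<lambda>x. complex_of_real (f x)))" (is "integrable lborel ?F")
  shows "AE x in lborel. f x = Re (fourier ?F (- x))"
proof (rule AE_eq_of_mollified_tendsto[OF f])
  have [measurable]: "?F \<in> borel_measurable borel" using borel_measurable_integrable[OF F] by simp
  have [measurable]: "(\<lambda>x::real^'n. cis (2 * pi * (x \<bullet> u))) \<in> borel_measurable borel" for u
    by (intro borel_measurable_continuous_onI continuous_intros)
  have cont: "continuous_on UNIV (\<lambda>x. Re (fourier ?F (- x)))"
    by (intro continuous_intros continuous_on_compose2[OF continuous_on_fourier[OF F]]) auto
  then show "(\<lambda>x. Re (fourier ?F (- x))) \<in> borel_measurable borel"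
    by (rule borel_measurable_continuous_onI)
  have dom: "norm (?F x * (cis (2 * pi * (x \<bullet> u)) * of_real (gauss y))) \<le> norm (?F x)" for x u and y :: "real ^ 'n"
  proof -
    have "norm (complex_of_real (gauss y)) \<le> 1"
      using gauss_le_1[of y] gauss_pos[of y] by simp
    then show ?thesis
      unfolding norm_mult norm_cis by (intro mult_left_le) auto
  qed
  have eq: "(LINT x|lborel. f x * mollifier (1 / real (Suc k)) (x - u)) =
      Re (LINT x|lborel. ?F x * (cis (2 * pi * (x \<bullet> u)) * of_real (gauss ((1 / real (Suc k)) *\<^sub>R x))))" for k u
    by (subst mollified_eq_fourier[OF f, symmetric]) (simp_all only: Re_complex_of_real, simp)
  show "\<bar>LINT x|lborel. f x * mollifier (1 / real (Suc k)) (x - u)\<bar> \<le> (LINT x|lborel. norm (?F x))" for k u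
  proof -
    have "norm (LINT x|lborel. ?F x * (cis (2 * pi * (x \<bullet> u)) * of_real (gauss ((1 / real (Suc k)) *\<^sub>R x)))) \<le> (LINT x|lborel. norm (?F x))"
    proof (rule Bochner_Integration.integral_norm_bound_integral[OF _ _ dom])
      show "integrable lborel (\<lambda>x. ?F x * (cis (2 * pi * (x \<bullet> u)) * of_real (gauss ((1 / real (Suc k)) *\<^sub>R x))))"
        by (rule Bochner_Integration.integrable_bound[OF F]) (use dom in auto)
    qed (use F in auto)
    then show ?thesis
      unfolding eq using abs_Re_le_cmod order_trans by blast
  qed
  show "(\<lambda>k. LINT x|lborel. f x * mollifier (1 / real (Suc k)) (x - u)) \<longlonglongrightarrow> Re (fourier ?F (- u))" for u
    unfolding eq
  proof (rule tendsto_Re)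
    have "(\<lambda>k. LINT x|lborel. ?F x * (cis (2 * pi * (x \<bullet> u)) * of_real (gauss ((1 / real (Suc k)) *\<^sub>R x))))
        \<longlonglongrightarrow> (LINT x|lborel. ?F x * (cis (2 * pi * (x \<bullet> u)) * of_real 1))"
    proof (rule integral_dominated_convergence[where w="\<lambda>x. norm (?F x)"])
      show "AE x in lborel. (\<lambda>k. ?F x * (cis (2 * pi * (x \<bullet> u)) * of_real (gauss ((1 / real (Suc k)) *\<^sub>R x))))
          \<longlonglongrightarrow> ?F x * (cis (2 * pi * (x \<bullet> u)) * of_real 1)"
        by (intro always_eventually allI tendsto_intros gauss_scaled_tendsto_1)
    qed (use F dom in auto)
    then show "(\<lambda>k. LINT x|lborel. ?F x * (cis (2 * pi * (x \<bullet> u)) * of_real (gauss ((1 / real (Suc k)) *\<^sub>R x))))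
        \<longlonglongrightarrow> fourier ?F (- u)"
      by (simp add: fourier_eq_cis)
  qed
qed

lemma fourier_inversion:
  fixes f :: "real ^ 'n \<Rightarrow> real"
  assumes f: "integrable lborel f" "continuous_on UNIV f"
    and F: "integrable lborel (fourier (\<lambda>x. complex_of_real (f x)))"
  shows "f x = Re (fourier (fourier (\<lambda>x. complex_of_real (f x))) (- x))"
proof -
  have "f = (\<lambda>x. Re (fourier (fourier (\<lambda>x. complex_of_real (f x))) (- x)))"
  proof (rule continuous_AE_eq[OF f(2) _ fourier_inversion_AE[OF f(1) F]])
    show "continuous_on UNIV (\<lambda>x. Re (fourier (fourier (\<lambda>x. complex_of_real (f x))) (- x)))"
      by (intro continuous_intros continuous_on_compose2[OF continuous_on_fourier[OF F]]) auto
  qed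
  then show ?thesis by metis
qed

section \<open>Compactly supported functions with compactly supported transform\<close>

text \<open>
  Along the line through \<open>v\<close> the Fourier transform of a compactly supported
  function extends to all complex arguments \<open>z\<close>, as an everywhere convergent power
  series: expand the exponential and integrate term by term.
\<close>

lemma fourier_line_power_series:
  fixes f :: "real ^ 'n \<Rightarrow> complex" and v :: "real ^ 'n" and z :: complex
  assumes f: "integrable lborel f" and supp: "\<And>x. norm x > R \<Longrightarrow> f x = 0" and R: "R \<ge> 0"
  shows "(\<lambda>k. (LINT x|lborel. f x * ((- (2 * pi * (x \<bullet> v)) * \<i>) ^ k / fact k)) * z ^ k) sums
      (LINT x|lborel. f x * exp (- (2 * pi * (x \<bullet> v)) * \<i> * z))"
proof -
  have [measurable]: "f \<in> borel_measurable borel" using borel_measurable_integrable[OF f] by simp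
  define M where "M = 2 * pi * (R * norm v) * norm z"
  have M: "M \<ge> 0" using R by (simp add: M_def)
  define t where "t k x = f x * ((- (2 * pi * (x \<bullet> v)) * \<i>) ^ k / fact k) * z ^ k" for k x
  have t_meas: "t k \<in> borel_measurable lborel" for k
    unfolding t_def by measurable
  have bound: "norm (t k x) \<le> norm (f x) * (M ^ k / fact k)" for k x
  proof (cases "norm x > R")
    case False
    then have "\<bar>x \<bullet> v\<bar> \<le> R * norm v"
      using Cauchy_Schwarz_ineq2[of x v] mult_right_mono[of "norm x" R "norm v"] norm_ge_zero[of v] by linarith
    then have "(2 * pi * \<bar>x \<bullet> v\<bar>) * norm z \<le> M"
      unfolding M_def by (intro mult_right_mono mult_left_mono) auto
    then have "((2 * pi * \<bar>x \<bullet> v\<bar>) * norm z) ^ k \<le> M ^ k"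
      by (intro power_mono) auto
    moreover have "norm (t k x) = norm (f x) * (((2 * pi * \<bar>x \<bullet> v\<bar>) * norm z) ^ k / fact k)"
      by (simp add: t_def norm_mult norm_divide norm_power power_mult_distrib abs_mult)
    ultimately show ?thesis by (simp add: divide_right_mono mult_left_mono)
  qed (simp add: supp t_def)
  have exp_sum: "summable (\<lambda>k. M ^ k / fact k)"
    using summable_exp[of M] by (simp add: divide_inverse mult.commute)
  have t_int: "integrable lborel (t k)" for k
  proof (rule Bochner_Integration.integrable_bound[OF _ t_meas])
    show "integrable lborel (\<lambda>x. norm (f x) * (M ^ k / fact k))"
      using f by (intro integrable_mult_left) auto
    have "norm (t k x) \<le> norm (norm (f x) * (M ^ k / fact k))" for x
      using bound[of k x] M by simp
    then show "AE x in lborel. norm (t k x) \<le> norm (norm (f x) * (M ^ k / fact k))"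
      by simp
  qed
  have "(\<lambda>k. LINT x|lborel. t k x) sums (LINT x|lborel. (\<Sum>k. t k x))"
  proof (rule sums_integral[OF t_int])
    show "AE x in lborel. summable (\<lambda>k. norm (t k x))"
    proof (intro always_eventually allI)
      fix x
      show "summable (\<lambda>k. norm (t k x))"
        by (rule summable_comparison_test'[of "\<lambda>k. norm (f x) * (M ^ k / fact k)" 0])
          (use exp_sum[THEN summable_mult, of "norm (f x)"] bound in auto)
    qed
    show "summable (\<lambda>k. LINT x|lborel. norm (t k x))"
    proof (rule summable_comparison_test'[of "\<lambda>k. (LINT x|lborel. norm (f x)) * (M ^ k / fact k)" 0])
      fix k
      have "(LINT x|lborel. norm (t k x)) \<le> (LINT x|lborel. norm (f x) * (M ^ k / fact k))"
        using f t_int bound by (intro integral_mono integrable_norm integrable_mult_left) auto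
      then show "norm (LINT x|lborel. norm (t k x)) \<le> (LINT x|lborel. norm (f x)) * (M ^ k / fact k)"
        by (simp add: integral_nonneg_AE)
    qed (rule summable_mult[OF exp_sum])
  qed
  moreover have "(\<Sum>k. t k x) = f x * exp (- (2 * pi * (x \<bullet> v)) * \<i> * z)" for x
  proof -
    have "(\<lambda>k. f x * ((- (2 * pi * (x \<bullet> v)) * \<i> * z) ^ k /\<^sub>R fact k)) sums
        (f x * exp (- (2 * pi * (x \<bullet> v)) * \<i> * z))"
      by (intro sums_mult exp_converges)
    moreover have "f x * ((- (2 * pi * (x \<bullet> v)) * \<i> * z) ^ k /\<^sub>R fact k) = t k x" for k
      unfolding t_def power_mult_distrib by (simp add: scaleR_conv_of_real divide_inverse mult_ac)
    ultimately show ?thesis by (simp add: sums_unique[symmetric])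
  qed
  moreover have "(LINT x|lborel. t k x) = (LINT x|lborel. f x * ((- (2 * pi * (x \<bullet> v)) * \<i>) ^ k / fact k)) * z ^ k" for k
    unfolding t_def by (rule integral_mult_left_zero)
  ultimately show ?thesis by simp
qed

text \<open>
  On each line through the origin the transform is an entire function that vanishes on a
  half-line.
\<close>

lemma fourier_zero_of_compact_supports:
  fixes f :: "real ^ 'n \<Rightarrow> complex"
  assumes f: "integrable lborel f"
    and supp: "\<And>x. norm x > R \<Longrightarrow> f x = 0"
    and supp_fourier: "\<And>y. norm y > R \<Longrightarrow> fourier f y = 0"
  shows "fourier f y = 0"
proof -
  define r where "r = max R 0"
  have r: "r \<ge> 0" "r \<ge> R" by (auto simp: r_def)
  obtain v t where v: "norm v = 1" and y: "y = t *\<^sub>R v"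
  proof (cases "y = 0")
    case True
    show ?thesis
    proof (rule that)
      show "norm (axis undefined 1 :: real ^ 'n) = 1" by simp
      show "y = 0 *\<^sub>R axis undefined 1" using True by simp
    qed
  next
    case False
    then show ?thesis using that[of "y /\<^sub>R norm y" "norm y"] by simp
  qed
  define H where "H z = (LINT x|lborel. f x * exp (- (2 * pi * (x \<bullet> v)) * \<i> * z))" for z
  have H_real: "H (of_real s) = fourier f (s *\<^sub>R v)" for s
    unfolding H_def fourier_def by (simp add: mult_ac)
  have hol: "H holomorphic_on ball 0 (r + \<bar>t\<bar> + 2)"
  proof (rule power_series_holomorphic)
    fix w :: complex
    show "(\<lambda>k. (LINT x|lborel. f x * ((- (2 * pi * (x \<bullet> v)) * \<i>) ^ k / fact k)) * (w - 0) ^ k) sums H w"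
      unfolding H_def diff_zero
      by (rule fourier_line_power_series[OF f _ r(1)]) (use supp r in auto)
  qed
  define \<xi> where "\<xi> = complex_of_real (r + 1)"
  define U where "U = complex_of_real ` {r<..<r + 2}"
  have "H (complex_of_real t) = 0"
  proof (rule analytic_continuation[OF hol])
    show "U \<subseteq> ball 0 (r + \<bar>t\<bar> + 2)" "\<xi> \<in> ball 0 (r + \<bar>t\<bar> + 2)" "complex_of_real t \<in> ball 0 (r + \<bar>t\<bar> + 2)"
      using r by (auto simp: U_def \<xi>_def simp del: of_real_add)
    show "H z = 0" if "z \<in> U" for z
    proof -
      from that obtain s where s: "z = of_real s" "s > r" by (auto simp: U_def)
      then have "norm (s *\<^sub>R v) > R" using r v by simp
      then show ?thesis unfolding s(1) H_real by (rule supp_fourier)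
    qed
    show "\<xi> islimpt U"
      unfolding islimpt_approachable
    proof (intro allI impI)
      fix e :: real assume e: "e > 0"
      define d where "d = min (e / 2) (1 / 2)"
      have d: "0 < d" "d < e" "d < 1" using e by (auto simp: d_def)
      have "complex_of_real (r + 1 + d) \<in> U" using d by (simp add: U_def del: of_real_add)
      moreover have "complex_of_real (r + 1 + d) \<noteq> \<xi>" using d by (simp add: \<xi>_def)
      moreover have "dist (complex_of_real (r + 1 + d)) \<xi> < e"
        using d by (simp add: \<xi>_def dist_norm)
      ultimately show "\<exists>x'\<in>U. x' \<noteq> \<xi> \<and> dist x' \<xi> < e" by blast
    qed
  qed auto
  then show ?thesis by (simp add: H_real y)
qed

section \<open>Near minimizers in nested convex sets\<close>

text \<open>
  A substitute for weak compactness in \<open>L\<^sup>2\<close>. The infima of the squared norm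
  over the sets \<open>C k\<close> increase to a finite limit; if \<open>u\<close> and
  \<open>v\<close> in \<open>C k\<close> nearly attain it, so does their midpoint, and the
  parallelogram law forces \<open>u - v\<close> to be small. By the last conclusion, other
  elements of \<open>C k\<close> of no larger norm are asymptotically equal to \<open>h
  k\<close>; it is what makes the limit inherit the symmetries of the sets \<open>C k\<close>.
\<close>

lemma nested_midpoint_convex_near_minimizers:
  fixes C :: "nat \<Rightarrow> ('a \<Rightarrow> real) set"
  assumes M: "finite_measure M"
    and nonempty: "\<And>k. C k \<noteq> {}"
    and nested: "\<And>k. C (Suc k) \<subseteq> C k"
    and measurable: "\<And>k g. g \<in> C k \<Longrightarrow> g \<in> borel_measurable M"
    and bounded: "\<And>k g x. g \<in> C k \<Longrightarrow> \<bar>g x\<bar> \<le> K"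
    and midpoint: "\<And>k g h. g \<in> C k \<Longrightarrow> h \<in> C k \<Longrightarrow> (\<lambda>x. (g x + h x) / 2) \<in> C k"
  obtains h f where "\<And>k. h k \<in> C k" and "f \<in> borel_measurable M"
    and "AE x in M. (\<lambda>k. h k x) \<longlonglongrightarrow> f x"
    and "\<And>h'. (\<And>k. h' k \<in> C k) \<Longrightarrow> (\<And>k. (LINT x|M. (h' k x)\<^sup>2) \<le> (LINT x|M. (h k x)\<^sup>2)) \<Longrightarrow>
      (\<lambda>k. LINT x|M. (h' k x - h k x)\<^sup>2) \<longlonglongrightarrow> 0"
proof -
  interpret finite_measure M by fact
  define q where "q g = (LINT x|M. (g x)\<^sup>2)" for g :: "'a \<Rightarrow> real"
  define \<mu> where "\<mu> = measure M (space M)"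
  have nested': "C j \<subseteq> C k" if "k \<le> j" for j k
    using that by (induct rule: dec_induct) (use nested in auto)
  have K: "0 \<le> K" using nonempty[of 0] bounded abs_ge_zero order_trans by blast
  have int_sq: "integrable M (\<lambda>x. (u x)\<^sup>2)" if u: "u \<in> borel_measurable M" and b: "\<And>x. \<bar>u x\<bar> \<le> B" for u :: "'a \<Rightarrow> real" and B
  proof (rule integrable_const_bound[where B="B\<^sup>2"])
    show "AE x in M. norm ((u x)\<^sup>2) \<le> B\<^sup>2"
      using b power_mono[OF b abs_ge_zero, of _ 2] by simp
  qed (use u in simp)
  have q_nonneg: "0 \<le> q g" for g unfolding q_def by (rule integral_nonneg_AE) simp
  have q_bound: "q g \<le> K\<^sup>2 * \<mu>" if g: "g \<in> C k" for g k
  proof -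
    have "q g \<le> (LINT x|M. K\<^sup>2)"
      unfolding q_def
      using int_sq[OF measurable[OF g] bounded[OF g]] power_mono[OF bounded[OF g] abs_ge_zero, of _ 2]
      by (intro integral_mono) auto
    then show ?thesis by (simp add: \<mu>_def mult.commute)
  qed
  define m where "m k = Inf (q ` C k)" for k
  have bdd: "bdd_below (q ` C k)" for k
    using q_nonneg by (auto intro!: bdd_belowI[of _ 0])
  have m_le: "m k \<le> q g" if "g \<in> C k" for g k
    unfolding m_def using that bdd by (intro cInf_lower) auto
  have "incseq m"
    unfolding m_def by (intro incseq_SucI cInf_superset_mono) (use nonempty nested bdd in auto)
  moreover have "m k \<le> K\<^sup>2 * \<mu>" for k
    using nonempty[of k] m_le q_bound order_trans by blast
  ultimately obtain L where L: "m \<longlonglongrightarrow> L" "\<And>k. m k \<le> L"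
    using incseq_convergent[of m "K\<^sup>2 * \<mu>"] by blast
  define e where "e k = (L - m k) + 1 / real (Suc k)" for k
  have "e \<longlonglongrightarrow> (L - L) + 0"
    unfolding e_def using lim_inverse_n' by (intro tendsto_intros L) (rule LIMSEQ_Suc)
  then have e: "e \<longlonglongrightarrow> 0" by simp
  have "\<exists>g. g \<in> C k \<and> q g < m k + 1 / real (Suc k)" for k
    using cInf_lessD[of "q ` C k" "m k + 1 / real (Suc k)"] nonempty[of k] by (auto simp: m_def)
  then obtain g where g: "\<And>k. g k \<in> C k" "\<And>k. q (g k) < m k + 1 / real (Suc k)"
    by metis
  have q_g: "q (g j) \<le> m k + e k" if "k \<le> j" for j k
  proof -
    have "1 / real (Suc j) \<le> 1 / real (Suc k)" using that by (simp add: frac_le)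
    then show ?thesis using g(2)[of j] L(2)[of j] by (simp add: e_def)
  qed
  have parallelogram: "q (\<lambda>x. u x - v x) \<le> 2 * (q u - m k) + 2 * (q v - m k)"
    if u: "u \<in> C k" and v: "v \<in> C k" for u v k
  proof -
    note int = int_sq[OF measurable[OF u] bounded[OF u]] int_sq[OF measurable[OF v] bounded[OF v]]
      int_sq[OF measurable[OF midpoint[OF u v]] bounded[OF midpoint[OF u v]]]
    have "(u x - v x)\<^sup>2 = 2 * (u x)\<^sup>2 + 2 * (v x)\<^sup>2 - 4 * ((u x + v x) / 2)\<^sup>2" for x
      by (simp add: power2_eq_square field_simps)
    then have "q (\<lambda>x. u x - v x) = 2 * q u + 2 * q v - 4 * q (\<lambda>x. (u x + v x) / 2)"
      unfolding q_def using int by simp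
    then show ?thesis using m_le[OF midpoint[OF u v]] by simp
  qed
  have "\<exists>N. \<forall>n\<ge>N. 4 * e n \<le> (1 / 4) ^ k" for k :: nat
  proof -
    have "(\<lambda>n. 4 * e n) \<longlonglongrightarrow> 4 * 0" by (intro tendsto_intros e)
    then have "eventually (\<lambda>n. 4 * e n < (1 / 4) ^ k) sequentially"
      by (rule order_tendstoD) simp
    then show ?thesis by (auto simp: eventually_sequentially intro: less_imp_le)
  qed
  then obtain N where N: "\<And>k n. N k \<le> n \<Longrightarrow> 4 * e n \<le> (1 / 4) ^ k" by metis
  \<comment> \<open>a monotone index sequence that dominates both \<open>N\<close> and the identity\<close>
  define s where "s k = (\<Sum>i\<le>k. N i) + k" for k
  have s: "k \<le> s k" "N k \<le> s k" "s k \<le> s (Suc k)" for k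
    by (auto simp: s_def intro: trans_le_add1 member_le_sum)
  define h where "h k = g (s k)" for k
  have h: "h k \<in> C k" for k
    unfolding h_def using g(1) nested'[OF s(1)] by blast
  note h_meas = measurable[OF h]
  have q_step: "q (\<lambda>x. h (Suc k) x - h k x) \<le> (1 / 4) ^ k" for k
  proof -
    have "h (Suc k) \<in> C (s k)" "h k \<in> C (s k)"
      unfolding h_def using g(1) nested'[OF s(3)] by auto
    then have "q (\<lambda>x. h (Suc k) x - h k x) \<le> 2 * (q (h (Suc k)) - m (s k)) + 2 * (q (h k) - m (s k))"
      by (rule parallelogram)
    also have "\<dots> \<le> 4 * e (s k)"
      using q_g[of "s k" "s (Suc k)"] q_g[of "s k" "s k"] s(3)[of k] by (simp add: h_def)
    also have "\<dots> \<le> (1 / 4) ^ k" using N[OF s(2)] .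
    finally show ?thesis .
  qed
  have step_int: "integrable M (\<lambda>x. \<bar>h (Suc k) x - h k x\<bar>)" for k
  proof (rule integrable_const_bound[where B="2 * K"])
    show "AE x in M. norm \<bar>h (Suc k) x - h k x\<bar> \<le> 2 * K"
      using bounded[OF h[of k]] bounded[OF h[of "Suc k"]] by (intro always_eventually allI) (smt (verit) real_norm_def)
  qed (use h_meas in measurable)
  have step_L1: "(LINT x|M. \<bar>h (Suc k) x - h k x\<bar>) \<le> (1 + \<mu>) * (1 / 2) ^ k" for k
  proof -
    let ?d = "\<lambda>x. h (Suc k) x - h k x"
    have d_meas: "?d \<in> borel_measurable M" using h_meas by measurable
    have d_bd: "\<bar>?d x\<bar> \<le> 2 * K" for x
      using bounded[OF h[of k], of x] bounded[OF h[of "Suc k"], of x] by linarith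
    have pt: "\<bar>?d x\<bar> \<le> 2 ^ k * (?d x)\<^sup>2 + (1 / 2) ^ k" for x
    proof -
      \<comment> \<open>with \<open>c = 2 ^ k\<close> this turns the summable squared norms of the increments into summable \<open>L\<^sup>1\<close> norms\<close>
      have amgm: "y \<le> c * y\<^sup>2 + 1 / c" if "0 \<le> y" "0 < c" for c y :: real
      proof -
        have "0 \<le> (c * y - 1)\<^sup>2" by simp
        then have "2 * y * c \<le> (c * y\<^sup>2 + 1 / c) * c"
          using that by (simp add: power2_eq_square algebra_simps)
        then have "2 * y \<le> c * y\<^sup>2 + 1 / c"
          using that(2) by (rule mult_right_le_imp_le)
        then show ?thesis using that(1) by linarith
      qed
      show ?thesis
        using amgm[of "\<bar>?d x\<bar>" "2 ^ k"] by (simp add: power_one_over)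
    qed
    have "(LINT x|M. \<bar>?d x\<bar>) \<le> (LINT x|M. 2 ^ k * (?d x)\<^sup>2 + (1 / 2) ^ k)"
      using pt int_sq[OF d_meas d_bd] by (intro integral_mono step_int) auto
    also have "\<dots> = 2 ^ k * q ?d + (1 / 2) ^ k * \<mu>"
      using int_sq[OF d_meas d_bd] by (simp add: q_def \<mu>_def mult.commute)
    also have "\<dots> \<le> 2 ^ k * (1 / 4) ^ k + (1 / 2) ^ k * \<mu>"
      using q_step[of k] by (intro add_right_mono mult_left_mono) auto
    also have "(2::real) ^ k * (1 / 4) ^ k = (1 / 2) ^ k"
      by (simp flip: power_mult_distrib)
    finally show ?thesis by (simp add: algebra_simps)
  qed
  have "(\<integral>\<^sup>+x. (\<Sum>k. ennreal \<bar>h (Suc k) x - h k x\<bar>) \<partial>M) = (\<Sum>k. \<integral>\<^sup>+x. ennreal \<bar>h (Suc k) x - h k x\<bar> \<partial>M)"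
    using h_meas by (intro nn_integral_suminf) measurable
  also have "\<dots> = (\<Sum>k. ennreal (LINT x|M. \<bar>h (Suc k) x - h k x\<bar>))"
    by (intro suminf_cong nn_integral_eq_integral step_int) simp
  also have "\<dots> \<noteq> \<infinity>"
  proof -
    have "summable (\<lambda>k. LINT x|M. \<bar>h (Suc k) x - h k x\<bar>)"
      by (rule summable_comparison_test'[of "\<lambda>k. (1 + \<mu>) * (1 / 2) ^ k" 0])
        (use step_L1 in \<open>auto intro!: summable_mult summable_geometric\<close>)
    then show ?thesis
      by (simp add: ennreal_suminf_neq_top)
  qed
  finally have "AE x in M. (\<Sum>k. ennreal \<bar>h (Suc k) x - h k x\<bar>) \<noteq> \<infinity>"
    using h_meas by (intro nn_integral_PInf_AE) measurable
  then have conv: "AE x in M. convergent (\<lambda>k. h k x)"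
  proof eventually_elim
    case (elim x)
    then have "summable (\<lambda>k. \<bar>h (Suc k) x - h k x\<bar>)"
      by (intro summable_suminf_not_top) auto
    then have "summable (\<lambda>k. h (Suc k) x - h k x)"
      by (rule summable_rabs_cancel)
    then have "(\<lambda>n. \<Sum>k<n. h (Suc k) x - h k x) \<longlonglongrightarrow> (\<Sum>k. h (Suc k) x - h k x)"
      by (rule summable_LIMSEQ)
    then have "(\<lambda>n. h n x - h 0 x) \<longlonglongrightarrow> (\<Sum>k. h (Suc k) x - h k x)"
      unfolding sum_lessThan_telescope[of "\<lambda>k. h k x"] .
    then have "(\<lambda>n. h n x - h 0 x + h 0 x) \<longlonglongrightarrow> (\<Sum>k. h (Suc k) x - h k x) + h 0 x"
      by (intro tendsto_intros)
    then show ?case by (auto simp: convergent_def)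
  qed
  show thesis
  proof (rule that[OF h])
    show "(\<lambda>x. lim (\<lambda>k. h k x)) \<in> borel_measurable M"
      using h_meas by measurable
    show "AE x in M. (\<lambda>k. h k x) \<longlonglongrightarrow> lim (\<lambda>k. h k x)"
      using conv by eventually_elim (simp add: convergent_LIMSEQ_iff)
    fix h' assume h': "\<And>k. h' k \<in> C k" "\<And>k. (LINT x|M. (h' k x)\<^sup>2) \<le> (LINT x|M. (h k x)\<^sup>2)"
    have "q (\<lambda>x. h' k x - h k x) \<le> 4 * e k" for k
      using parallelogram[OF h'(1) h, of k] h'(2)[of k] q_g[OF s(1), of k] by (simp add: q_def h_def)
    then have le: "\<forall>k. norm (q (\<lambda>x. h' k x - h k x)) \<le> 4 * e k" using q_nonneg by simp
    have lim: "(\<lambda>k. 4 * e k) \<longlonglongrightarrow> 0" using tendsto_mult[OF tendsto_const e, of 4] by simp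
    have "(\<lambda>k. q (\<lambda>x. h' k x - h k x)) \<longlonglongrightarrow> 0"
      by (rule Lim_null_comparison[OF always_eventually[OF le] lim])
    then show "(\<lambda>k. LINT x|M. (h' k x - h k x)\<^sup>2) \<longlonglongrightarrow> 0" by (simp add: q_def)
  qed
qed

section \<open>Self-dual competitors\<close>

definition self_dual :: "(real ^ 'n \<Rightarrow> real) \<Rightarrow> bool" where
  "self_dual g \<longleftrightarrow> integrable lborel g \<and>
    (\<forall>y. fourier (\<lambda>x. complex_of_real (g x)) y = complex_of_real (g y))"

lemma self_dualD:
  assumes "self_dual g"
  shows self_dual_integrable: "integrable lborel g"
    and self_dual_fourier: "fourier (\<lambda>x. complex_of_real (g x)) y = complex_of_real (g y)"
  using assms by (auto simp: self_dual_def)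

lemma self_dual_continuous:
  fixes g :: "real ^ 'n \<Rightarrow> real"
  assumes "self_dual g"
  shows "continuous_on UNIV g"
proof -
  have "continuous_on UNIV (\<lambda>y. Re (fourier (\<lambda>x. complex_of_real (g x)) y))"
    using assms by (intro continuous_intros continuous_on_fourier) (simp add: self_dual_def)
  then show ?thesis using assms by (simp add: self_dual_def)
qed

lemma self_dual_measurable: "self_dual g \<Longrightarrow> g \<in> borel_measurable borel"
  by (intro borel_measurable_continuous_onI self_dual_continuous)

lemma self_dual_even:
  assumes g: "self_dual g"
  shows "g (- x) = g x"
  using fourier_minus[of g x] by (simp add: self_dual_fourier[OF g])

lemma self_dual_bound:
  assumes g: "self_dual g"
  shows "\<bar>g x\<bar> \<le> (LINT x|lborel. \<bar>g x\<bar>)"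
  using norm_fourier_le[of "\<lambda>x. complex_of_real (g x)" x] by (simp add: self_dual_fourier[OF g])

lemma self_dual_0:
  assumes g: "self_dual g"
  shows "g 0 = (LINT x|lborel. g x)"
proof -
  have "complex_of_real (g 0) = complex_of_real (LINT x|lborel. g x)"
    using self_dual_fourier[OF g, of 0] by (simp add: fourier_eq_cis)
  then show ?thesis by (simp only: of_real_eq_iff)
qed

lemma self_dual_add:
  assumes "self_dual f" "self_dual g"
  shows "self_dual (\<lambda>x. f x + g x)"
  using assms by (simp add: self_dual_def fourier_add)

lemma self_dual_cmult:
  assumes "self_dual g"
  shows "self_dual (\<lambda>x. c * g x)"
  using assms by (simp add: self_dual_def fourier_cmult)

lemma self_dual_orthogonal:
  fixes Q :: "real ^ 'n \<Rightarrow> real ^ 'n"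
  assumes g: "self_dual g" and Q: "orthogonal_transformation Q"
  shows "self_dual (\<lambda>x. g (Q x))"
proof -
  have [measurable]: "g \<in> borel_measurable borel" using g by (rule self_dual_measurable)
  show ?thesis
    unfolding self_dual_def
    using g integrable_lborel_orthogonal[OF Q, of g] fourier_orthogonal[OF Q, of "\<lambda>x. complex_of_real (g x)"]
    by (simp add: self_dual_def)
qed

lemma self_dual_gauss: "self_dual gauss"
  by (simp add: self_dual_def integrable_gauss fourier_gauss)

text \<open>
  The zero function belongs to every one of these sets, which keeps them convex cones;
  nontriviality is enforced separately, by prescribing the integral over a ball.
\<close>

definition competitors :: "real \<Rightarrow> (real ^ 'n \<Rightarrow> real) set" where
  "competitors R = {g. self_dual g \<and> g 0 \<le> 0 \<and> (\<forall>x. norm x > R \<longrightarrow> 0 \<le> g x)}"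

lemma competitorsD:
  assumes "g \<in> competitors R"
  shows "self_dual g" "g 0 \<le> 0" "norm x > R \<Longrightarrow> 0 \<le> g x"
  using assms by (auto simp: competitors_def)

lemma competitors_cmult:
  "g \<in> competitors R \<Longrightarrow> 0 \<le> c \<Longrightarrow> (\<lambda>x. c * g x) \<in> competitors R"
  by (auto simp: competitors_def self_dual_cmult mult_nonneg_nonpos)

lemma competitors_add:
  "f \<in> competitors R \<Longrightarrow> g \<in> competitors R \<Longrightarrow>
    (\<lambda>x. f x + g x) \<in> competitors R"
  by (auto simp: competitors_def self_dual_add add_nonpos_nonpos)

lemma competitors_orthogonal:
  fixes Q :: "real ^ 'n \<Rightarrow> real ^ 'n"
  assumes "g \<in> competitors R" and Q: "orthogonal_transformation Q"
  shows "(\<lambda>x. g (Q x)) \<in> competitors R"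
  using assms orthogonal_transformation_norm[OF Q] linear_0[OF orthogonal_transformation_linear[OF Q]]
  by (auto simp: competitors_def self_dual_orthogonal)

definition ball_integral :: "real \<Rightarrow> (real ^ 'n \<Rightarrow> real) \<Rightarrow> real" where
  "ball_integral R g = (LINT x|lborel. indicator (cball 0 R) x * g x)"

lemma
  assumes g: "integrable lborel g"
  shows integrable_ball: "integrable lborel (\<lambda>x. indicator (cball 0 R) x * g x :: real)"
    and integrable_outside: "integrable lborel (\<lambda>x. indicator (- cball 0 R) x * g x :: real)"
  using integrable_mult_indicator[OF _ g, of "cball 0 R"] integrable_mult_indicator[OF _ g, of "- cball 0 R"]
  by simp_all

lemma ball_integral_cmult: "ball_integral R (\<lambda>x. c * g x) = c * ball_integral R g"
  unfolding ball_integral_def by (simp add: mult.left_commute)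

lemma ball_integral_orthogonal:
  fixes Q :: "real ^ 'n \<Rightarrow> real ^ 'n"
  assumes Q: "orthogonal_transformation Q" and [measurable]: "g \<in> borel_measurable borel"
  shows "ball_integral R (\<lambda>x. g (Q x)) = ball_integral R g"
proof -
  have "indicator (cball 0 R) x = (indicator (cball 0 R) (Q x) :: real)" for x
    using orthogonal_transformation_norm[OF Q, of x] by (simp add: indicator_def)
  moreover have "(\<lambda>x. indicator (cball 0 R) x * g x) \<in> borel_measurable borel"
    by (intro borel_measurable_times borel_measurable_indicator) auto
  ultimately show ?thesis
    unfolding ball_integral_def
    using integral_lborel_orthogonal[OF Q, of "\<lambda>x. indicator (cball 0 R) x * g x"] by simp
qed

lemma integral_outside:
  assumes "self_dual g"
  shows "(LINT x|lborel. indicator (- cball 0 R) x * g x) = g 0 - ball_integral R g"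
proof -
  note int = self_dual_integrable[OF assms]
  have "(LINT x|lborel. g x) = (LINT x|lborel. indicator (cball 0 R) x * g x + indicator (- cball 0 R) x * g x)"
    by (intro Bochner_Integration.integral_cong refl) (auto simp: indicator_def)
  then show ?thesis
    using integrable_ball[OF int, of R] integrable_outside[OF int, of R]
    by (simp add: self_dual_0[OF assms] ball_integral_def)
qed

section \<open>The mass of a competitor inside the ball\<close>

text \<open>
  The integral of a self-dual function is its value at 0, so the nonnegative mass outside the
  ball is compensated inside it.
\<close>

lemma outside_mass_le:
  assumes g: "g \<in> competitors R"
  shows "0 \<le> (LINT x|lborel. indicator (- cball 0 R) x * g x)"
    and "(LINT x|lborel. indicator (- cball 0 R) x * g x) \<le> - ball_integral R g"
proof -
  show "0 \<le> (LINT x|lborel. indicator (- cball 0 R) x * g x)"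
    using competitorsD(3)[OF g] by (intro integral_nonneg_AE always_eventually allI) (auto simp: indicator_def)
  show "(LINT x|lborel. indicator (- cball 0 R) x * g x) \<le> - ball_integral R g"
    using integral_outside[OF competitorsD(1)[OF g], of R] competitorsD(2)[OF g] by simp
qed

lemma integral_abs_split:
  fixes g :: "real ^ 'n \<Rightarrow> real"
  assumes g: "g \<in> competitors R"
  shows "(LINT x|lborel. \<bar>g x\<bar>) =
    (LINT x|lborel. \<bar>indicator (cball 0 R) x * g x\<bar>) + (LINT x|lborel. indicator (- cball 0 R) x * g x)"
proof -
  have int: "integrable lborel g"
    using competitorsD(1)[OF g] by (rule self_dual_integrable)
  have "(LINT x|lborel. \<bar>g x\<bar>) = (LINT x|lborel. \<bar>indicator (cball 0 R) x * g x\<bar> + indicator (- cball 0 R) x * g x)"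
    using competitorsD(3)[OF g]
    by (intro Bochner_Integration.integral_cong refl) (auto simp: indicator_def)
  then show ?thesis
    using integrable_abs[OF integrable_ball[OF int, of R]] integrable_outside[OF int, of R] by simp
qed

text \<open>
  Since the mass outside the ball \<open>B\<close> tends to 0, \<open>f n\<close> is uniformly
  close to the transform of its restriction \<open>b n\<close> to \<open>B\<close>, and these
  transforms are equicontinuous. A uniform limit \<open>p\<close> on \<open>B\<close>, extended
  by 0 to \<open>\<phi>\<close>, is an \<open>L\<^sup>1\<close> limit of the \<open>b n\<close>,
  hence has norm 1. Outside \<open>B\<close> the transform of \<open>\<phi>\<close> is the
  pointwise limit of the \<open>f n\<close>, whose mass there vanishes in the limit. So
  \<open>\<phi>\<close> and its transform are both supported in \<open>B\<close>, which forces
  \<open>\<phi> = 0\<close>.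
\<close>

lemma normalized_concentrating_sequence_False:
  fixes f :: "nat \<Rightarrow> real ^ 'n \<Rightarrow> real"
  assumes R: "R \<ge> 0" and f: "\<And>n. f n \<in> competitors R"
    and norm1: "\<And>n. (LINT x|lborel. \<bar>f n x\<bar>) = 1"
    and small: "\<And>n. - ball_integral R (f n) \<le> 1 / real (Suc n)"
  shows False
proof -
  let ?B = "cball 0 R :: (real ^ 'n) set"
  note sd = competitorsD(1)[OF f]
  have f_int: "integrable lborel (f n)" for n using sd by (rule self_dual_integrable)
  have f_meas [measurable]: "f n \<in> borel_measurable borel" for n using sd by (rule self_dual_measurable)
  have f_le_1: "\<bar>f n x\<bar> \<le> 1" for n x using self_dual_bound[OF sd, of n x] norm1 by simp
  have out: "(LINT x|lborel. indicator (- ?B) x * f n x) \<le> 1 / real (Suc n)" for n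
    using outside_mass_le(2)[OF f, of n] small[of n] by linarith
  define b where "b n x = complex_of_real (indicator ?B x * f n x)" for n x
  have b_int: "integrable lborel (b n)" for n
    unfolding b_def by (intro integrable_of_real integrable_ball f_int)
  have b_meas [measurable]: "b n \<in> borel_measurable borel" for n
    using borel_measurable_integrable[OF b_int] by simp
  have b_le: "norm (b n x) \<le> indicator ?B x" for n x
    using f_le_1[of n x] by (simp add: b_def indicator_def)
  have b_norm: "(LINT x|lborel. norm (b n x)) = 1 - (LINT x|lborel. indicator (- ?B) x * f n x)" for n
    using integral_abs_split[OF f, of n] norm1[of n] unfolding b_def norm_of_real by linarith
  have b_norm_le: "(LINT x|lborel. norm (b n x)) \<le> 1" for n
    using b_norm outside_mass_le(1)[OF f, of n] by simp
  have approx: "norm (complex_of_real (f n y) - fourier (b n) y) \<le> 1 / real (Suc n)" for n y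
  proof -
    let ?o = "\<lambda>x. complex_of_real (indicator (- ?B) x * f n x)"
    have o: "integrable lborel ?o" by (intro integrable_of_real integrable_outside f_int)
    have "(\<lambda>x. complex_of_real (f n x)) = (\<lambda>x. b n x + ?o x)"
      by (auto simp: b_def indicator_def)
    then have "complex_of_real (f n y) = fourier (b n) y + fourier ?o y"
      using self_dual_fourier[OF sd, of n y] fourier_add[OF b_int o, of n y] by simp
    then have "norm (complex_of_real (f n y) - fourier (b n) y) = norm (fourier ?o y)" by simp
    also have "\<dots> \<le> (LINT x|lborel. norm (?o x))" by (rule norm_fourier_le)
    also have "\<dots> = (LINT x|lborel. indicator (- ?B) x * f n x)"
      using competitorsD(3)[OF f]
      by (intro Bochner_Integration.integral_cong refl) (auto simp: indicator_def)
    finally show ?thesis using out[of n] by linarith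
  qed
  have lip: "norm (fourier (b n) y - fourier (b n) z) \<le> 2 * pi * R * norm (y - z)" for n y z
  proof -
    have "norm (fourier (b n) y - fourier (b n) z) \<le> 2 * pi * R * norm (y - z) * (LINT x|lborel. norm (b n x))"
      by (rule fourier_lipschitz[OF b_int _ R]) (simp add: b_def)
    also have "\<dots> \<le> 2 * pi * R * norm (y - z) * 1"
      using R b_norm_le by (intro mult_left_mono) auto
    finally show ?thesis by simp
  qed
  obtain p and k :: "nat \<Rightarrow> nat" where p: "continuous_on ?B p" and k: "strict_mono k"
    and unif: "\<And>e. 0 < e \<Longrightarrow> \<exists>N. \<forall>n x. n \<ge> N \<and> x \<in> ?B \<longrightarrow> norm (fourier (b (k n)) x - p x) < e"
  proof (rule Arzela_Ascoli[of ?B "\<lambda>n. fourier (b n)" 1])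
    show "norm (fourier (b n) x) \<le> 1" for n x
      using norm_fourier_le b_norm_le by (rule order_trans)
    show "\<exists>d. 0 < d \<and> (\<forall>n y. y \<in> ?B \<and> norm (x - y) < d \<longrightarrow> norm (fourier (b n) x - fourier (b n) y) < e)"
      if "0 < e" for x e
    proof (intro exI[of _ "e / (2 * pi * R + 1)"] conjI allI impI)
      have pos: "2 * pi * R + 1 > 0" using R by (intro add_nonneg_pos) auto
      then show "0 < e / (2 * pi * R + 1)" using that by simp
      fix n y assume "y \<in> ?B \<and> norm (x - y) < e / (2 * pi * R + 1)"
      then have "(2 * pi * R + 1) * norm (x - y) < e"
        using pos by (simp add: pos_less_divide_eq mult.commute)
      moreover have "2 * pi * R * norm (x - y) \<le> (2 * pi * R + 1) * norm (x - y)"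
        by (intro mult_right_mono) auto
      ultimately show "norm (fourier (b n) x - fourier (b n) y) < e"
        using lip[of n x y] by linarith
    qed
  qed auto
  have inv0: "(\<lambda>n. 1 / real (Suc (k n))) \<longlonglongrightarrow> 0"
    using LIMSEQ_subseq_LIMSEQ[OF LIMSEQ_Suc[OF lim_inverse_n'] k] by (simp add: o_def)
  have p_lim: "(\<lambda>n. fourier (b (k n)) x) \<longlonglongrightarrow> p x" if "x \<in> ?B" for x
    unfolding LIMSEQ_iff using unif that by meson
  have f_diff: "(\<lambda>n. complex_of_real (f (k n) y) - fourier (b (k n)) y) \<longlonglongrightarrow> 0" for y
    by (rule Lim_null_comparison[OF always_eventually inv0]) (use approx in blast)
  define \<phi> where "\<phi> x = indicator ?B x *\<^sub>R p x" for x
  have \<phi>_meas [measurable]: "\<phi> \<in> borel_measurable borel"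
    unfolding \<phi>_def using p by (intro borel_measurable_continuous_on_indicator) auto
  have b_lim: "(\<lambda>n. b (k n) x) \<longlonglongrightarrow> \<phi> x" for x
  proof (cases "x \<in> ?B")
    case True
    then show ?thesis
      using tendsto_add[OF f_diff[of x] p_lim[OF True]] True by (simp add: b_def \<phi>_def)
  qed (simp add: b_def \<phi>_def)
  have ind_int: "integrable lborel (indicator ?B :: _ \<Rightarrow> real)"
    using emeasure_lborel_cball_finite[of "0 :: real ^ 'n" R] by simp
  have \<phi>_int: "integrable lborel \<phi>"
    by (rule integrable_dominated_convergence[where s="\<lambda>n. b (k n)" and w="indicator ?B"])
      (use ind_int b_lim b_le in auto)
  have fourier_lim: "(\<lambda>n. fourier (b (k n)) y) \<longlonglongrightarrow> fourier \<phi> y" for y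
    unfolding fourier_eq_cis
  proof (rule integral_dominated_convergence[where w="indicator ?B"])
    show "AE x in lborel. (\<lambda>n. b (k n) x * cis (- (2 * pi * (x \<bullet> y)))) \<longlonglongrightarrow> \<phi> x * cis (- (2 * pi * (x \<bullet> y)))"
      by (intro always_eventually allI tendsto_mult tendsto_const b_lim)
  qed (use ind_int b_le borel_measurable_integrable[OF integrable_fourier_integrand[OF b_int]]
      borel_measurable_integrable[OF integrable_fourier_integrand[OF \<phi>_int]] in \<open>auto simp: norm_mult\<close>)
  have norm_lim: "(\<lambda>n. LINT x|lborel. norm (b (k n) x)) \<longlonglongrightarrow> (LINT x|lborel. norm (\<phi> x))"
  proof (rule integral_dominated_convergence[where w="indicator ?B"])
    show "AE x in lborel. (\<lambda>n. norm (b (k n) x)) \<longlonglongrightarrow> norm (\<phi> x)"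
      by (intro always_eventually allI tendsto_norm b_lim)
  qed (use ind_int b_le in auto)
  have "(\<lambda>n. 1 - 1 / real (Suc (k n))) \<longlonglongrightarrow> 1 - 0"
    by (intro tendsto_intros inv0)
  then have \<phi>_norm: "1 \<le> (LINT x|lborel. norm (\<phi> x))"
    using norm_lim b_norm out by (intro LIMSEQ_le[OF _ norm_lim, of _ 1]) (auto intro!: exI[of _ 0])
  have f_lim: "(\<lambda>n. complex_of_real (f (k n) y)) \<longlonglongrightarrow> fourier \<phi> y" for y
    using tendsto_add[OF f_diff[of y] fourier_lim[of y]] by simp
  define F where "F y = Re (fourier \<phi> y)" for y
  have F_lim: "(\<lambda>n. f (k n) y) \<longlonglongrightarrow> F y" for y
    using tendsto_Re[OF f_lim[of y]] by (simp add: F_def)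
  have fourier_F: "fourier \<phi> y = complex_of_real (F y)" for y
    using LIMSEQ_unique[OF f_lim tendsto_of_real[OF F_lim]] .
  have F_cont: "continuous_on UNIV F"
    unfolding F_def by (intro continuous_intros continuous_on_fourier \<phi>_int)
  have F_meas [measurable]: "F \<in> borel_measurable borel"
    using F_cont by (rule borel_measurable_continuous_onI)
  have F_nonneg: "0 \<le> F y" if "norm y > R" for y
    using competitorsD(3)[OF f that] by (intro LIMSEQ_le_const[OF F_lim]) auto
  \<comment> \<open>the weight \<open>gauss\<close> makes dominated convergence available outside the ball\<close>
  let ?w = "\<lambda>u x. indicator (- ?B) x * u x * gauss x :: real"
  have w_le: "norm (?w (f n) x) \<le> gauss x" for n x
    using f_le_1[of n x] gauss_pos[of x] by (simp add: indicator_def abs_mult mult_left_le_one_le)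
  have w_lim: "(\<lambda>n. LINT x|lborel. ?w (f (k n)) x) \<longlonglongrightarrow> (LINT x|lborel. ?w F x)"
  proof (rule integral_dominated_convergence[where w=gauss])
    show "AE x in lborel. (\<lambda>n. ?w (f (k n)) x) \<longlonglongrightarrow> ?w F x"
      by (intro always_eventually allI tendsto_mult tendsto_const F_lim)
  qed (use integrable_gauss w_le in auto)
  have w_int: "integrable lborel (?w F)"
  proof (rule integrable_dominated_convergence[where s="\<lambda>n. ?w (f (k n))" and w=gauss])
    show "AE x in lborel. (\<lambda>n. ?w (f (k n)) x) \<longlonglongrightarrow> ?w F x"
      by (intro always_eventually allI tendsto_mult tendsto_const F_lim)
  qed (use integrable_gauss w_le in auto)
  have w_small: "norm (LINT x|lborel. ?w (f n) x) \<le> 1 / real (Suc n)" for n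
  proof -
    have nonneg: "0 \<le> ?w (f n) x" and le: "?w (f n) x \<le> indicator (- ?B) x * f n x" for x
      using competitorsD(3)[OF f, of x n] gauss_pos[of x] gauss_le_1[of x]
      by (auto simp: indicator_def mult_left_le)
    have "integrable lborel (?w (f n))"
      by (rule Bochner_Integration.integrable_bound[OF integrable_gauss])
        (use w_le in \<open>auto intro: order_trans[OF _ abs_ge_self]\<close>)
    then have "(LINT x|lborel. ?w (f n) x) \<le> (LINT x|lborel. indicator (- ?B) x * f n x)"
      using le by (intro integral_mono integrable_outside f_int) auto
    moreover have "0 \<le> (LINT x|lborel. ?w (f n) x)"
      using nonneg by (intro integral_nonneg_AE) auto
    ultimately show ?thesis using out[of n] by simp
  qed
  have "(\<lambda>n. LINT x|lborel. ?w (f (k n)) x) \<longlonglongrightarrow> 0"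
    by (rule Lim_null_comparison[OF always_eventually inv0]) (use w_small in blast)
  with w_lim have "(LINT x|lborel. ?w F x) = 0" by (rule LIMSEQ_unique)
  moreover have "AE x in lborel. 0 \<le> ?w F x"
    using F_nonneg by (intro always_eventually allI) (simp add: indicator_def less_imp_le[OF gauss_pos])
  ultimately have "AE x in lborel. ?w F x = 0"
    using integral_nonneg_eq_0_iff_AE[OF w_int] by simp
  then have F_AE: "AE x in lborel. x \<in> - ?B \<longrightarrow> F x = 0"
    by eventually_elim (auto simp: indicator_def gauss_def)
  have F_zero: "F y = 0" if "norm y > R" for y
    by (rule continuous_AE_eq_on[of "- ?B", OF _ _ _ F_AE])
      (use that F_cont in \<open>auto intro: continuous_on_subset\<close>)
  have fourier_zero: "fourier \<phi> y = 0" for y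
  proof (rule fourier_zero_of_compact_supports[OF \<phi>_int])
    show "\<phi> x = 0" if "norm x > R" for x using that by (simp add: \<phi>_def)
    show "fourier \<phi> y = 0" if "norm y > R" for y
      using F_zero[OF that] by (simp only: fourier_F of_real_0)
  qed
  have "p x = 0" if "x \<in> ?B" for x
    using LIMSEQ_unique[OF p_lim[OF that] fourier_lim[of x]] by (simp only: fourier_zero)
  then have "\<phi> x = 0" for x by (simp add: \<phi>_def indicator_def)
  then show False using \<phi>_norm by simp
qed

text \<open>
  The constant depends on \<open>R\<close> alone, which gives bounds that are uniform along a
  decreasing sequence of radii.
\<close>

lemma inner_mass_uniform:
  assumes R: "R \<ge> 0"
  obtains c where "c > 0"
    and "\<And>g :: real ^ 'n \<Rightarrow> real. g \<in> competitors R \<Longrightarrow>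
      c * (LINT x|lborel. \<bar>g x\<bar>) \<le> - ball_integral R g"
proof -
  have "\<exists>n. \<forall>g :: real ^ 'n \<Rightarrow> real. g \<in> competitors R \<longrightarrow>
      1 / real (Suc n) * (LINT x|lborel. \<bar>g x\<bar>) \<le> - ball_integral R g"
  proof (rule ccontr)
    assume "\<not> ?thesis"
    then have "\<exists>g :: real ^ 'n \<Rightarrow> real. g \<in> competitors R \<and>
      - ball_integral R g < 1 / real (Suc n) * (LINT x|lborel. \<bar>g x\<bar>)" for n
      by (auto simp: not_le)
    then obtain g :: "nat \<Rightarrow> real ^ 'n \<Rightarrow> real" where g: "\<And>n. g n \<in> competitors R"
      and small: "\<And>n. - ball_integral R (g n) < 1 / real (Suc n) * (LINT x|lborel. \<bar>g n x\<bar>)"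
      by metis
    define L where "L n = (LINT x|lborel. \<bar>g n x\<bar>)" for n
    have L: "L n > 0" for n
    proof -
      have "0 < 1 / real (Suc n) * L n"
        using outside_mass_le[OF g, of n] small[of n] by (simp add: L_def)
      then show ?thesis by (simp add: zero_less_divide_iff)
    qed
    show False
    proof (rule normalized_concentrating_sequence_False[OF R, of "\<lambda>n x. (1 / L n) * g n x"])
      fix n
      show "(\<lambda>x. (1 / L n) * g n x) \<in> competitors R"
        using L[of n] by (intro competitors_cmult g) simp
      show "(LINT x|lborel. \<bar>(1 / L n) * g n x\<bar>) = 1"
        using L[of n] by (simp add: abs_mult L_def[symmetric])
      show "- ball_integral R (\<lambda>x. (1 / L n) * g n x) \<le> 1 / real (Suc n)"
      proof -
        have "(1 / L n) * - ball_integral R (g n) \<le> (1 / L n) * (1 / real (Suc n) * L n)"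
          using small[of n] L[of n] by (intro mult_left_mono) (auto simp: L_def)
        then show ?thesis
          using L[of n] unfolding ball_integral_cmult by (simp del: of_nat_Suc)
      qed
    qed
  qed
  then show thesis using that[of "1 / real (Suc n)" for n] by auto
qed

section \<open>Compactness of the competitors\<close>

text \<open>
  Pointwise convergence with an \<open>L\<^sup>1\<close> bound does not give convergence of the
  Fourier transforms, since mass may escape to infinity. Gaussian weights cut that mass off: the
  identity between the mollified function and the weighted transform passes to the limit, and
  only then is the weight removed, using that the limit itself is integrable.
\<close>

lemma AE_limit_self_dual:
  fixes h :: "nat \<Rightarrow> real ^ 'n \<Rightarrow> real"
  assumes h: "\<And>k. self_dual (h k)" and K: "\<And>k. (LINT x|lborel. \<bar>h k x\<bar>) \<le> K"
    and f0_meas [measurable]: "f0 \<in> borel_measurable borel"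
    and lim: "AE x in lborel. (\<lambda>k. h k x) \<longlonglongrightarrow> f0 x"
  obtains f where "self_dual f" and "AE x in lborel. f0 x = f x"
proof -
  have h_int: "integrable lborel (h k)" for k using h by (rule self_dual_integrable)
  have h_meas [measurable]: "h k \<in> borel_measurable borel" for k using h by (rule self_dual_measurable)
  have h_le: "\<bar>h k x\<bar> \<le> K" for k x using self_dual_bound[OF h, of k x] K[of k] by linarith
  have "integrable lborel (\<lambda>x. \<bar>f0 x\<bar>)"
  proof (rule Fatou_integral_le(1)[where u="\<lambda>k x. \<bar>h k x\<bar>" and c=K])
    show "AE x in lborel. (\<lambda>k. \<bar>h k x\<bar>) \<longlonglongrightarrow> \<bar>f0 x\<bar>"
      using lim by eventually_elim (rule tendsto_rabs)
  qed (use h_int K in auto)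
  then have f0_int: "integrable lborel f0" by (simp add: integrable_abs_iff)
  have cis_meas [measurable]: "(\<lambda>x::real^'n. cis (c * (x \<bullet> u))) \<in> borel_measurable borel" for c u
    by (intro borel_measurable_continuous_onI continuous_intros)
  have mean: "complex_of_real (LINT x|lborel. f0 x * mollifier \<epsilon> (x - u)) =
      (LINT x|lborel. complex_of_real (f0 x) * (cis (2 * pi * (x \<bullet> u)) * of_real (gauss (\<epsilon> *\<^sub>R x))))"
    if \<epsilon>: "\<epsilon> > 0" for \<epsilon> u
  proof -
    have mollifier_int: "integrable lborel (\<lambda>x. K * mollifier \<epsilon> (x - u))"
    proof -
      have "integrable lborel (\<lambda>x. gauss (- (u /\<^sub>R \<epsilon>) + (1 / \<epsilon>) *\<^sub>R x))"
        using \<epsilon> integrable_gauss by (subst integrable_lborel_affine) auto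
      moreover have "gauss (- (u /\<^sub>R \<epsilon>) + (1 / \<epsilon>) *\<^sub>R x) = \<epsilon> ^ DIM(real ^ 'n) * mollifier \<epsilon> (x - u)" for x
        using \<epsilon> by (simp add: mollifier_def scaleR_diff_right divide_inverse_commute)
      ultimately show ?thesis using \<epsilon> by simp
    qed
    have gauss_int: "integrable lborel (\<lambda>x::real^'n. K * gauss (\<epsilon> *\<^sub>R x))"
      using \<epsilon> integrable_gauss integrable_lborel_affine[of \<epsilon> gauss 0] by auto
    have left: "(\<lambda>k. LINT x|lborel. h k x * mollifier \<epsilon> (x - u)) \<longlonglongrightarrow> (LINT x|lborel. f0 x * mollifier \<epsilon> (x - u))"
    proof (rule integral_dominated_convergence[where w="\<lambda>x. K * mollifier \<epsilon> (x - u)"])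
      show "AE x in lborel. (\<lambda>k. h k x * mollifier \<epsilon> (x - u)) \<longlonglongrightarrow> f0 x * mollifier \<epsilon> (x - u)"
        using lim by eventually_elim (intro tendsto_intros)
      have "norm (h k x * mollifier \<epsilon> (x - u)) \<le> K * mollifier \<epsilon> (x - u)" for k x
        using h_le[of k x] mollifier_pos[OF \<epsilon>, of "x - u"] by (simp add: abs_mult mult_right_mono)
      then show "AE x in lborel. norm (h k x * mollifier \<epsilon> (x - u)) \<le> K * mollifier \<epsilon> (x - u)" for k
        by simp
    qed (use mollifier_int in auto)
    have right: "(\<lambda>k. LINT x|lborel. complex_of_real (h k x) * (cis (2 * pi * (x \<bullet> u)) * of_real (gauss (\<epsilon> *\<^sub>R x))))
        \<longlonglongrightarrow> (LINT x|lborel. complex_of_real (f0 x) * (cis (2 * pi * (x \<bullet> u)) * of_real (gauss (\<epsilon> *\<^sub>R x))))"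
    proof (rule integral_dominated_convergence[where w="\<lambda>x. K * gauss (\<epsilon> *\<^sub>R x)"])
      show "AE x in lborel. (\<lambda>k. complex_of_real (h k x) * (cis (2 * pi * (x \<bullet> u)) * of_real (gauss (\<epsilon> *\<^sub>R x))))
          \<longlonglongrightarrow> complex_of_real (f0 x) * (cis (2 * pi * (x \<bullet> u)) * of_real (gauss (\<epsilon> *\<^sub>R x)))"
        using lim by eventually_elim (intro tendsto_intros)
      have "norm (complex_of_real (h k x) * (cis (2 * pi * (x \<bullet> u)) * of_real (gauss (\<epsilon> *\<^sub>R x)))) \<le> K * gauss (\<epsilon> *\<^sub>R x)" for k x
        using h_le[of k x] gauss_pos[of "\<epsilon> *\<^sub>R x"] by (simp add: norm_mult mult_right_mono)
      then show "AE x in lborel. norm (complex_of_real (h k x) * (cis (2 * pi * (x \<bullet> u)) * of_real (gauss (\<epsilon> *\<^sub>R x)))) \<le> K * gauss (\<epsilon> *\<^sub>R x)" for k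
        by simp
    qed (use gauss_int in auto)
    have eq: "complex_of_real (LINT x|lborel. h k x * mollifier \<epsilon> (x - u)) =
        (LINT x|lborel. complex_of_real (h k x) * (cis (2 * pi * (x \<bullet> u)) * of_real (gauss (\<epsilon> *\<^sub>R x))))" for k
      using mollified_eq_fourier[OF h_int \<epsilon>, of k u] unfolding self_dual_fourier[OF h] .
    show ?thesis
      by (rule LIMSEQ_unique[OF tendsto_of_real[OF left]]) (unfold eq, rule right)
  qed
  \<comment> \<open>the left-hand side is real, so the sign in the exponent may be flipped by conjugation\<close>
  have mean': "complex_of_real (LINT x|lborel. f0 x * mollifier \<epsilon> (x - u)) =
      (LINT x|lborel. complex_of_real (f0 x) * cis (- (2 * pi * (x \<bullet> u))) * of_real (gauss (\<epsilon> *\<^sub>R x)))"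
    if \<epsilon>: "\<epsilon> > 0" for \<epsilon> u
  proof -
    have "complex_of_real (LINT x|lborel. f0 x * mollifier \<epsilon> (x - u)) =
        cnj (complex_of_real (LINT x|lborel. f0 x * mollifier \<epsilon> (x - u)))"
      by (rule complex_cnj_complex_of_real[symmetric])
    also have "\<dots> = (LINT x|lborel. cnj (complex_of_real (f0 x) * (cis (2 * pi * (x \<bullet> u)) * of_real (gauss (\<epsilon> *\<^sub>R x)))))"
      unfolding mean[OF \<epsilon>] by (rule Bochner_Integration.integral_cnj[symmetric])
    finally show ?thesis by (simp add: cis_cnj mult.assoc)
  qed
  let ?F = "fourier (\<lambda>x. complex_of_real (f0 x))"
  let ?D = "\<lambda>k u. LINT x|lborel. f0 x * mollifier (1 / real (Suc k)) (x - u)"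
  have dom: "norm (complex_of_real (f0 x) * cis (- (2 * pi * (x \<bullet> u))) * of_real (gauss y)) \<le> \<bar>f0 x\<bar>" for x u and y :: "real ^ 'n"
    using gauss_le_1[of y] gauss_pos[of y] by (simp add: norm_mult mult_left_le)
  have D_lim: "(\<lambda>k. complex_of_real (?D k u)) \<longlonglongrightarrow> ?F u" for u
  proof -
    have "(\<lambda>k. LINT x|lborel. complex_of_real (f0 x) * cis (- (2 * pi * (x \<bullet> u))) * of_real (gauss ((1 / real (Suc k)) *\<^sub>R x)))
        \<longlonglongrightarrow> (LINT x|lborel. complex_of_real (f0 x) * cis (- (2 * pi * (x \<bullet> u))) * of_real 1)"
    proof (rule integral_dominated_convergence[where w="\<lambda>x. \<bar>f0 x\<bar>"])
      show "AE x in lborel. (\<lambda>k. complex_of_real (f0 x) * cis (- (2 * pi * (x \<bullet> u))) * of_real (gauss ((1 / real (Suc k)) *\<^sub>R x)))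
          \<longlonglongrightarrow> complex_of_real (f0 x) * cis (- (2 * pi * (x \<bullet> u))) * of_real 1"
        by (intro always_eventually allI tendsto_intros gauss_scaled_tendsto_1)
      show "(\<lambda>x. complex_of_real (f0 x) * cis (- (2 * pi * (x \<bullet> u))) * of_real 1) \<in> borel_measurable lborel"
        using cis_meas[of "- (2 * pi)" u] by simp
      show "(\<lambda>x. complex_of_real (f0 x) * cis (- (2 * pi * (x \<bullet> u))) * of_real (gauss ((1 / real (Suc k)) *\<^sub>R x))) \<in> borel_measurable lborel" for k
        using cis_meas[of "- (2 * pi)" u] by simp
    qed (use f0_int dom in auto)
    moreover have "complex_of_real (?D k u) =
        (LINT x|lborel. complex_of_real (f0 x) * cis (- (2 * pi * (x \<bullet> u))) * of_real (gauss ((1 / real (Suc k)) *\<^sub>R x)))" for k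
      by (rule mean') simp
    ultimately show ?thesis by (simp only: fourier_eq_cis of_real_1 mult_1_right)
  qed
  define f where "f u = Re (?F u)" for u
  have D_lim': "(\<lambda>k. ?D k u) \<longlonglongrightarrow> f u" for u
    using tendsto_Re[OF D_lim[of u]] by (simp only: f_def Re_complex_of_real)
  have F_f: "?F u = complex_of_real (f u)" for u
    using LIMSEQ_unique[OF D_lim tendsto_of_real[OF D_lim']] .
  have f_cont: "continuous_on UNIV f"
    unfolding f_def using f0_int by (intro continuous_intros continuous_on_fourier) auto
  have f_meas [measurable]: "f \<in> borel_measurable borel"
    using f_cont by (rule borel_measurable_continuous_onI)
  have AE: "AE x in lborel. f0 x = f x"
  proof (rule AE_eq_of_mollified_tendsto[OF f0_int f_meas _ D_lim'])
    fix k u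
    have "complex_of_real (?D k u) =
        (LINT x|lborel. complex_of_real (f0 x) * cis (- (2 * pi * (x \<bullet> u))) * of_real (gauss ((1 / real (Suc k)) *\<^sub>R x)))"
      by (rule mean') simp
    also have "norm \<dots> \<le> (LINT x|lborel. \<bar>f0 x\<bar>)"
    proof (rule order_trans[OF integral_norm_bound integral_mono'])
      show "integrable lborel (\<lambda>x. \<bar>f0 x\<bar>)" using f0_int by simp
    qed (use dom in auto)
    finally have "norm (complex_of_real (?D k u)) \<le> (LINT x|lborel. \<bar>f0 x\<bar>)" .
    then show "\<bar>?D k u\<bar> \<le> (LINT x|lborel. \<bar>f0 x\<bar>)" by (simp only: norm_of_real)
  qed
  have "fourier (\<lambda>x. complex_of_real (f x)) = ?F"
    by (rule fourier_cong_AE) (use AE in \<open>auto elim: eventually_mono\<close>)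
  moreover have "integrable lborel f"
    using f0_int AE by (subst integrable_cong_AE[of f _ f0]) (auto elim: eventually_mono)
  ultimately have "self_dual f"
    by (simp only: self_dual_def F_f simp_thms)
  then show thesis using AE by (rule that)
qed

text \<open>
  The sets \<open>C k\<close> below consist of the competitors for \<open>R k\<close> whose
  integral over the fixed ball of radius \<open>R 0\<close> is \<open>-1\<close>; the norm that
  is minimized over them is the \<open>L\<^sup>2\<close> norm with Gaussian weight, which is
  finite for bounded functions and invariant under rotations.
\<close>

lemma exists_radial_limit:
  fixes R :: "nat \<Rightarrow> real"
  assumes R_nonneg: "\<And>k. 0 \<le> R k" and R_dec: "\<And>k. R (Suc k) \<le> R k"
    and ex: "\<And>k. \<exists>g :: real ^ 'n \<Rightarrow> real. g \<in> competitors (R k) \<and> g \<noteq> (\<lambda>x. 0)"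
  obtains f :: "real ^ 'n \<Rightarrow> real" where "f \<noteq> (\<lambda>x. 0)" and "self_dual f" and "f 0 \<le> 0"
    and "\<And>x y. norm x = norm y \<Longrightarrow> f x = f y" and "\<And>x k. norm x > R k \<Longrightarrow> 0 \<le> f x"
proof -
  let ?B = "cball 0 (R 0) :: (real ^ 'n) set"
  have R_anti: "R j \<le> R k" if "k \<le> j" for j k
    using that by (induct rule: dec_induct) (use R_dec order_trans in blast)+
  obtain c where c: "c > 0" and mass: "\<And>g :: real ^ 'n \<Rightarrow> real. g \<in> competitors (R 0) \<Longrightarrow>
      c * (LINT x|lborel. \<bar>g x\<bar>) \<le> - ball_integral (R 0) g"
    using inner_mass_uniform[OF R_nonneg[of 0]] by blast
  have competitors_mono: "competitors (R j) \<subseteq> competitors (R k)" if "k \<le> j" for j k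
    using R_anti[OF that] by (auto simp: competitors_def)
  define C where "C k = {g :: real ^ 'n \<Rightarrow> real. g \<in> competitors (R k) \<and> ball_integral (R 0) g = -1}" for k
  have C_competitor: "g \<in> competitors (R k)" and C_sd: "self_dual g" and C_ball: "ball_integral (R 0) g = -1"
    if "g \<in> C k" for g k
    using that by (auto simp: C_def competitors_def)
  have C_competitor0: "g \<in> competitors (R 0)" if "g \<in> C k" for g k
    using C_competitor[OF that] competitors_mono[of 0 k] by auto
  have C_L1: "(LINT x|lborel. \<bar>g x\<bar>) \<le> 1 / c" if "g \<in> C k" for g k
    using mass[OF C_competitor0[OF that]] C_ball[OF that] c by (simp add: pos_le_divide_eq mult.commute)
  have C_le: "\<bar>g x\<bar> \<le> 1 / c" if "g \<in> C k" for g k x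
    using self_dual_bound[OF C_sd[OF that], of x] C_L1[OF that] by linarith
  have C_nonempty: "C k \<noteq> {}" for k
  proof -
    obtain g :: "real ^ 'n \<Rightarrow> real" where g: "g \<in> competitors (R k)" "g \<noteq> (\<lambda>x. 0)" using ex by blast
    then obtain x where "g x \<noteq> 0" by auto
    then have "0 < (LINT x|lborel. \<bar>g x\<bar>)"
      using self_dual_bound[OF competitorsD(1)[OF g(1)], of x] by linarith
    then have "0 < c * (LINT x|lborel. \<bar>g x\<bar>)" using c by simp
    also have "\<dots> \<le> - ball_integral (R 0) g"
      using g(1) competitors_mono[of 0 k] by (intro mass) auto
    finally have pos: "0 < - ball_integral (R 0) g" .
    then have "(\<lambda>x. (1 / - ball_integral (R 0) g) * g x) \<in> C k"
      unfolding C_def mem_Collect_eq ball_integral_cmult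
      by (intro conjI competitors_cmult g(1)) auto
    then show ?thesis by blast
  qed
  define M where "M = density lborel (\<lambda>x::real ^ 'n. ennreal (gauss x))"
  have M_meas: "u \<in> borel_measurable M \<longleftrightarrow> u \<in> borel_measurable borel" for u :: "real ^ 'n \<Rightarrow> real"
    by (simp add: M_def cong: measurable_cong_sets)
  have M_int: "(LINT x|M. u x) = (LINT x|lborel. gauss x * u x)" if "u \<in> borel_measurable borel" for u :: "real ^ 'n \<Rightarrow> real"
    unfolding M_def using that by (subst integral_density) (auto simp: less_imp_le[OF gauss_pos])
  have M_AE: "(AE x in M. P x) \<longleftrightarrow> (AE x in lborel. P x)" for P :: "real ^ 'n \<Rightarrow> bool"
    unfolding M_def by (subst AE_density) (auto simp: gauss_pos)
  have M_fin: "finite_measure M"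
  proof
    have "emeasure M (space M) = (\<integral>\<^sup>+x. ennreal (gauss (x::real ^ 'n)) \<partial>lborel)"
      by (simp add: M_def emeasure_density)
    also have "\<dots> = 1"
      by (subst nn_integral_eq_integral[OF integrable_gauss]) (auto simp: integral_gauss less_imp_le[OF gauss_pos])
    finally show "emeasure M (space M) \<noteq> \<infinity>" by simp
  qed
  obtain h f0 where h: "\<And>k. h k \<in> C k" and f0: "f0 \<in> borel_measurable M"
    and conv: "AE x in M. (\<lambda>k. h k x) \<longlonglongrightarrow> f0 x"
    and near_min: "\<And>h'. (\<And>k. h' k \<in> C k) \<Longrightarrow> (\<And>k. (LINT x|M. (h' k x)\<^sup>2) \<le> (LINT x|M. (h k x)\<^sup>2)) \<Longrightarrow>
      (\<lambda>k. LINT x|M. (h' k x - h k x)\<^sup>2) \<longlonglongrightarrow> 0"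
  proof (rule nested_midpoint_convex_near_minimizers[OF M_fin, of C "1 / c"])
    show "C k \<noteq> {}" for k by (rule C_nonempty)
    show "C (Suc k) \<subseteq> C k" for k using competitors_mono[of k "Suc k"] by (auto simp: C_def)
    show "g \<in> borel_measurable M" if "g \<in> C k" for g k
      unfolding M_meas by (rule self_dual_measurable[OF C_sd[OF that]])
    show "\<bar>g x\<bar> \<le> 1 / c" if "g \<in> C k" for g k x by (rule C_le[OF that])
    show "(\<lambda>x. (g x + u x) / 2) \<in> C k" if g: "g \<in> C k" and u: "u \<in> C k" for g u k
    proof -
      have eq: "(\<lambda>x. (g x + u x) / 2) = (\<lambda>x. (1 / 2) * (g x + u x))" by auto
      have "(\<lambda>x. (1 / 2) * (g x + u x)) \<in> competitors (R k)"
        by (intro competitors_cmult competitors_add C_competitor[OF g] C_competitor[OF u]) auto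
      moreover have "ball_integral (R 0) (\<lambda>x. g x + u x) = ball_integral (R 0) g + ball_integral (R 0) u"
        using integrable_ball[OF self_dual_integrable[OF C_sd[OF g]], of "R 0"]
          integrable_ball[OF self_dual_integrable[OF C_sd[OF u]], of "R 0"]
        by (simp add: ball_integral_def distrib_left)
      ultimately show ?thesis
        unfolding C_def mem_Collect_eq eq ball_integral_cmult using C_ball[OF g] C_ball[OF u] by simp
    qed
  qed blast
  note h_sd = C_sd[OF h]
  note h_int = self_dual_integrable[OF h_sd]
  have h_meas [measurable]: "h k \<in> borel_measurable borel" for k by (rule self_dual_measurable[OF h_sd])
  obtain f where f: "self_dual f" and f0_f: "AE x in lborel. f0 x = f x"
    using AE_limit_self_dual[of h "1 / c" f0] h_sd C_L1[OF h] f0 conv unfolding M_meas M_AE by blast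
  have lim: "AE x in lborel. (\<lambda>k. h k x) \<longlonglongrightarrow> f x"
    using conv[unfolded M_AE] f0_f by eventually_elim simp
  have f_meas [measurable]: "f \<in> borel_measurable borel" by (rule self_dual_measurable[OF f])
  have f_cont: "continuous_on UNIV f" by (rule self_dual_continuous[OF f])
  have f_nonneg_pt: "0 \<le> f x" if conv: "(\<lambda>k. h k x) \<longlonglongrightarrow> f x" and x: "norm x > R k" for x k
  proof (rule LIMSEQ_le_const[OF conv])
    have "0 \<le> h j x" if "k \<le> j" for j
      using competitorsD(3)[OF C_competitor[OF h], of j x] R_anti[OF that] x by simp
    then show "\<exists>N. \<forall>j\<ge>N. 0 \<le> h j x" by blast
  qed
  have f_nonneg: "0 \<le> f x" if x: "norm x > R k" for x k
  proof (rule continuous_nonneg_of_AE[of "- cball (0 :: real ^ 'n) (R k)" f])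
    show "AE y in lborel. y \<in> - cball 0 (R k) \<longrightarrow> 0 \<le> f y"
      using lim by eventually_elim (use f_nonneg_pt[of _ k] in \<open>auto simp: not_le\<close>)
  qed (use x f_cont in auto)
  have ball: "ball_integral (R 0) f = -1"
  proof -
    have ind_int: "integrable lborel (\<lambda>x. (1 / c) * indicator ?B x :: real)"
      using emeasure_lborel_cball_finite[of "0 :: real ^ 'n" "R 0"] by simp
    have "(\<lambda>k. ball_integral (R 0) (h k)) \<longlonglongrightarrow> ball_integral (R 0) f"
      unfolding ball_integral_def
    proof (rule integral_dominated_convergence[where w="\<lambda>x. (1 / c) * indicator ?B x"])
      show "AE x in lborel. (\<lambda>k. indicator ?B x * h k x) \<longlonglongrightarrow> indicator ?B x * f x"
        using lim by eventually_elim (intro tendsto_intros)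
      have "norm (indicator ?B x * h k x) \<le> (1 / c) * indicator ?B x" for k x
        using C_le[OF h, of k x] by (simp add: indicator_def)
      then show "AE x in lborel. norm (indicator ?B x * h k x) \<le> (1 / c) * indicator ?B x" for k
        by simp
    qed (use ind_int borel_measurable_integrable[OF integrable_ball[OF h_int]]
        borel_measurable_integrable[OF integrable_ball[OF self_dual_integrable[OF f]]] in auto)
    then show ?thesis using C_ball[OF h] by (simp add: LIMSEQ_const_iff)
  qed
  \<comment> \<open>mass may be lost outside the ball in the limit, but it is nonnegative there, so the integral can only drop\<close>
  have out: "(LINT x|lborel. indicator (- ?B) x * f x) \<le> 1"
  proof (rule Fatou_integral_le(2)[where u="\<lambda>k x. indicator (- ?B) x * h k x"])
    show "integrable lborel (\<lambda>x. indicator (- ?B) x * h k x)" for k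
      by (rule integrable_outside[OF h_int])
    show "0 \<le> indicator (- ?B) x * h k x" for k x
      using competitorsD(3)[OF C_competitor0[OF h], of x k] by (simp add: indicator_def)
    show "(LINT x|lborel. indicator (- ?B) x * h k x) \<le> 1" for k
      using outside_mass_le(2)[OF C_competitor0[OF h], of k] C_ball[OF h, of k] by simp
    show "AE x in lborel. (\<lambda>k. indicator (- ?B) x * h k x) \<longlonglongrightarrow> indicator (- ?B) x * f x"
      using lim by eventually_elim (intro tendsto_intros)
    show "(\<lambda>x. indicator (- ?B) x * f x) \<in> borel_measurable lborel"
      by (rule borel_measurable_integrable[OF integrable_outside[OF self_dual_integrable[OF f]]])
  qed
  have f_0: "f 0 \<le> 0"
    using integral_outside[OF f, of "R 0"] out ball by linarith
  have invariant: "f (Q x) = f x" if Q: "orthogonal_transformation Q" for Q x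
  proof -
    have [measurable]: "Q \<in> borel_measurable borel" by (rule borel_measurable_orthogonal[OF Q])
    have gauss_Q: "gauss (Q y) = gauss y" for y
      using orthogonal_transformation_norm[OF Q] by (simp add: gauss_def)
    \<comment> \<open>the rotated functions are near minimizers, too, hence asymptotically equal to \<open>h\<close>\<close>
    have "(\<lambda>k. LINT x|M. (h k (Q x) - h k x)\<^sup>2) \<longlonglongrightarrow> 0"
    proof (rule near_min)
      show "(\<lambda>x. h k (Q x)) \<in> C k" for k
        using competitors_orthogonal[OF C_competitor[OF h] Q] C_ball[OF h]
        by (simp add: C_def ball_integral_orthogonal[OF Q])
      have "(LINT x|lborel. gauss (Q x) * (h k (Q x))\<^sup>2) = (LINT x|lborel. gauss x * (h k x)\<^sup>2)" for k
        by (rule integral_lborel_orthogonal[OF Q]) measurable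
      then show "(LINT x|M. (h k (Q x))\<^sup>2) \<le> (LINT x|M. (h k x)\<^sup>2)" for k
        by (simp add: M_int gauss_Q)
    qed
    moreover have "(\<lambda>k. LINT x|M. (h k (Q x) - h k x)\<^sup>2) \<longlonglongrightarrow> (LINT x|M. (f (Q x) - f x)\<^sup>2)"
    proof (rule integral_dominated_convergence[where w="\<lambda>_. (2 / c)\<^sup>2"])
      show "AE x in M. (\<lambda>k. (h k (Q x) - h k x)\<^sup>2) \<longlonglongrightarrow> (f (Q x) - f x)\<^sup>2"
        unfolding M_AE using lim AE_orthogonal[OF Q lim]
        by eventually_elim (intro tendsto_intros)
      have "\<bar>h k (Q x) - h k x\<bar> \<le> 2 / c" for k x
        using C_le[OF h, of k x] C_le[OF h, of k "Q x"] by linarith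
      from power_mono[OF this abs_ge_zero, of _ _ 2]
      show "AE x in M. norm ((h k (Q x) - h k x)\<^sup>2) \<le> (2 / c)\<^sup>2" for k
        by simp
      show "integrable M (\<lambda>_. (2 / c)\<^sup>2)"
        using finite_measure.integrable_const[OF M_fin] .
    qed (simp_all add: M_meas)
    ultimately have "(LINT x|M. (f (Q x) - f x)\<^sup>2) = 0" by (rule LIMSEQ_unique[rotated])
    moreover have "integrable M (\<lambda>x. (f (Q x) - f x)\<^sup>2)"
    proof (rule finite_measure.integrable_const_bound[OF M_fin])
      show "AE x in M. norm ((f (Q x) - f x)\<^sup>2) \<le> (2 * (LINT x|lborel. \<bar>f x\<bar>))\<^sup>2"
      proof (intro always_eventually allI)
        fix x
        have "\<bar>f (Q x) - f x\<bar> \<le> 2 * (LINT x|lborel. \<bar>f x\<bar>)"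
          using self_dual_bound[OF f, of x] self_dual_bound[OF f, of "Q x"] by linarith
        from power_mono[OF this abs_ge_zero, of 2] show "norm ((f (Q x) - f x)\<^sup>2) \<le> (2 * (LINT x|lborel. \<bar>f x\<bar>))\<^sup>2"
          by simp
      qed
    qed (simp add: M_meas)
    ultimately have "AE x in M. (f (Q x) - f x)\<^sup>2 = 0"
      using integral_nonneg_eq_0_iff_AE[of M "\<lambda>x. (f (Q x) - f x)\<^sup>2"] by simp
    then have AE: "AE x in lborel. x \<in> UNIV \<longrightarrow> f (Q x) = f x"
      unfolding M_AE by eventually_elim simp
    have cont_Q: "continuous_on UNIV (\<lambda>x. f (Q x))"
      by (intro continuous_on_compose2[OF f_cont continuous_on_orthogonal[OF Q]]) auto
    show ?thesis
      by (rule continuous_AE_eq_on[where f="\<lambda>x. f (Q x)" and S=UNIV, OF open_UNIV cont_Q f_cont AE]) simp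
  qed
  show thesis
  proof (rule that[OF _ f f_0 _ f_nonneg])
    show "f \<noteq> (\<lambda>x. 0)" using ball by (auto simp: ball_integral_def)
    show "f x = f y" if xy: "norm x = norm y" for x y
    proof -
      obtain Q where "orthogonal_transformation Q" "Q x = y"
        using orthogonal_transformation_exists[OF xy] .
      then show ?thesis using invariant[of Q x] by simp
    qed
  qed
qed

section \<open>From admissible functions to competitors\<close>

lemma last_sign_change_lessD:
  assumes "last_sign_change g < ennreal r" and "norm x > r"
  shows "0 \<le> g x"
proof -
  from assms(1) obtain r' where "r' > 0" "\<forall>x. norm x > r' \<longrightarrow> g x \<ge> 0" "ennreal r' < ennreal r"
    unfolding last_sign_change_def Inf_less_iff by auto
  then show ?thesis using assms(2) by (simp add: ennreal_less_iff)
qed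

lemma last_sign_change_le:
  assumes "r > 0" and "\<And>x. norm x > r \<Longrightarrow> 0 \<le> g x"
  shows "last_sign_change g \<le> ennreal r"
  unfolding last_sign_change_def using assms by (intro Inf_lower) auto

text \<open>
  A continuous function that is nonnegative off the origin and has integral at most 0 vanishes.
  Thus neither factor of the product in \<open>uncertainty_inf\<close> is 0, and a finite
  product has finite factors.
\<close>

lemma last_sign_change_nonzero:
  fixes g :: "real ^ 'n \<Rightarrow> real"
  assumes g: "continuous_on UNIV g" "integrable lborel g" "(LINT x|lborel. g x) \<le> 0" "g \<noteq> (\<lambda>x. 0)"
  shows "last_sign_change g \<noteq> 0"
proof
  assume zero: "last_sign_change g = 0"
  have off_origin: "0 \<le> g x" if "x \<noteq> 0" for x
    using that by (intro last_sign_change_lessD[of g "norm x / 2"]) (auto simp: zero)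
  have nonneg: "AE x in lborel. 0 \<le> g x"
    using AE_lborel_singleton[of "0 :: real ^ 'n"] by eventually_elim (rule off_origin)
  then have "(LINT x|lborel. g x) = 0"
    using integral_nonneg_AE[OF nonneg] g(3) by linarith
  then have "AE x in lborel. g x = 0"
    using integral_nonneg_eq_0_iff_AE[OF g(2) nonneg] by simp
  then have "g = (\<lambda>x. 0)"
    using g(1) by (intro continuous_AE_eq) auto
  with g(4) show False by contradiction
qed

lemma fourier_real_0: "fourier_real f 0 = (LINT x|lborel. f x)"
  by (simp add: fourier_real_def fourier_eq_cis)

lemma admissibleD:
  fixes f :: "real ^ 'n \<Rightarrow> real"
  assumes "f \<in> admissible"
  shows "f \<noteq> (\<lambda>x. 0)" "f (- x) = f x" "continuous_on UNIV f" "integrable lborel f"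
    "integrable lborel (fourier (\<lambda>x. complex_of_real (f x)))" "f 0 \<le> 0" "fourier_real f 0 \<le> 0"
  using assms by (auto simp: admissible_def)

lemma admissible_fourier:
  fixes f :: "real ^ 'n \<Rightarrow> real"
  assumes f: "f \<in> admissible"
  shows "fourier (\<lambda>x. complex_of_real (f x)) = (\<lambda>y. complex_of_real (fourier_real f y))"
    and "integrable lborel (fourier_real f)"
    and "continuous_on UNIV (fourier_real f)"
    and "fourier (\<lambda>x. complex_of_real (fourier_real f x)) y = complex_of_real (f y)"
    and "fourier_real f \<noteq> (\<lambda>x. 0)"
proof -
  note f = admissibleD[OF f]
  show eq: "fourier (\<lambda>x. complex_of_real (f x)) = (\<lambda>y. complex_of_real (fourier_real f y))"
    using fourier_even[OF f(4) f(2)] by auto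
  show int: "integrable lborel (fourier_real f)"
    using integrable_Re[OF f(5)] by (simp add: fourier_real_def[abs_def])
  show "continuous_on UNIV (fourier_real f)"
    unfolding fourier_real_def[abs_def] using f(4) by (intro continuous_intros continuous_on_fourier) auto
  have even: "fourier_real f (- x) = fourier_real f x" for x
    by (simp add: fourier_real_def fourier_minus)
  have inv: "fourier_real (fourier_real f) y = f y" for y
    using fourier_inversion[OF f(4) f(3) f(5), of "- y"] unfolding eq by (simp add: fourier_real_def f(2))
  show "fourier (\<lambda>x. complex_of_real (fourier_real f x)) y = complex_of_real (f y)"
    using fourier_even[OF int even, of y] unfolding inv .
  show "fourier_real f \<noteq> (\<lambda>x. 0)"
  proof
    assume zero: "fourier_real f = (\<lambda>x. 0)"
    have "f y = 0" for y using inv[of y] unfolding zero by (simp add: fourier_real_def fourier_eq_cis)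
    with f(1) show False by auto
  qed
qed

text \<open>
  If \<open>f\<close> and its transform \<open>F\<close> were to cancel, then \<open>f\<close>
  and \<open>- f = F\<close> would both be nonnegative beyond \<open>\<rho>\<close>, so both
  would be compactly supported.
\<close>

lemma symmetrized_competitor:
  fixes f :: "real ^ 'n \<Rightarrow> real"
  assumes f: "f \<in> admissible"
    and nonneg: "\<And>x. norm x > \<rho> \<Longrightarrow> 0 \<le> f x" and nonneg_fourier: "\<And>x. norm x > \<rho> \<Longrightarrow> 0 \<le> fourier_real f x"
  shows "\<exists>g :: real ^ 'n \<Rightarrow> real. g \<in> competitors \<rho> \<and> g \<noteq> (\<lambda>x. 0)"
proof (intro exI conjI)
  note F = admissible_fourier[OF f]
  note f' = admissibleD[OF f]
  let ?g = "\<lambda>x. f x + fourier_real f x"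
  have "self_dual ?g"
    using f'(4) F(2) by (simp add: self_dual_def fourier_add F(1) F(4))
  then show "?g \<in> competitors \<rho>"
    using f'(6,7) nonneg nonneg_fourier by (simp add: competitors_def add_nonpos_nonpos)
  show "?g \<noteq> (\<lambda>x. 0)"
  proof
    assume "?g = (\<lambda>x. 0)"
    then have eq: "fourier_real f x = - f x" for x by (simp add: fun_eq_iff add_eq_0_iff2)
    have zero: "f x = 0" if "norm x > \<rho>" for x
      using nonneg[OF that] nonneg_fourier[OF that] by (simp add: eq)
    have "fourier (\<lambda>x. complex_of_real (f x)) y = 0" for y
      by (rule fourier_zero_of_compact_supports[of _ \<rho>])
        (use f'(4) zero in \<open>simp_all add: F(1) eq\<close>)
    then have "fourier_real f = (\<lambda>x. 0)" by (auto simp: fourier_real_def)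
    with F(5) show False by contradiction
  qed
qed

lemma admissible_dilate:
  fixes f :: "real ^ 'n \<Rightarrow> real"
  assumes f: "f \<in> admissible" and c: "c > 0"
  shows "(\<lambda>x. f (c *\<^sub>R x)) \<in> admissible"
    and "fourier_real (\<lambda>x. f (c *\<^sub>R x)) y = 1 / c ^ CARD('n) * fourier_real f (y /\<^sub>R c)"
proof -
  note f' = admissibleD[OF f]
  have [measurable]: "f \<in> borel_measurable borel" using f'(3) by (rule borel_measurable_continuous_onI)
  have eq: "fourier (\<lambda>x. complex_of_real (f (c *\<^sub>R x))) =
      (\<lambda>y. of_real (1 / c ^ CARD('n)) * fourier (\<lambda>x. complex_of_real (f x)) (0 + (1 / c) *\<^sub>R y))"
    using fourier_scale[OF c, of "\<lambda>x. complex_of_real (f x)"] by (simp add: fun_eq_iff divide_inverse)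
  show fr: "fourier_real (\<lambda>x. f (c *\<^sub>R x)) y = 1 / c ^ CARD('n) * fourier_real f (y /\<^sub>R c)" for y
    unfolding fourier_real_def eq by (simp add: divide_inverse flip: of_real_power of_real_inverse)
  show "(\<lambda>x. f (c *\<^sub>R x)) \<in> admissible"
    unfolding admissible_def mem_Collect_eq
  proof (intro conjI allI)
    show "(\<lambda>x. f (c *\<^sub>R x)) \<noteq> (\<lambda>x. 0)"
    proof
      assume zero: "(\<lambda>x. f (c *\<^sub>R x)) = (\<lambda>x. 0)"
      have "f x = 0" for x using fun_cong[OF zero, of "x /\<^sub>R c"] c by simp
      with f'(1) show False by auto
    qed
    show "f (c *\<^sub>R - x) = f (c *\<^sub>R x)" for x using f'(2)[of "c *\<^sub>R x"] by simp
    show "continuous_on UNIV (\<lambda>x. f (c *\<^sub>R x))"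
      by (intro continuous_on_compose2[OF f'(3)] continuous_intros) auto
    show "integrable lborel (\<lambda>x. f (c *\<^sub>R x))"
      using integrable_lborel_affine[of c f 0] c f'(4) by simp
    have "integrable lborel (\<lambda>y. fourier (\<lambda>x. complex_of_real (f x)) (0 + (1 / c) *\<^sub>R y))"
      using c f'(4,5) by (subst integrable_lborel_affine) (auto intro!: borel_measurable_fourier)
    then show "integrable lborel (fourier (\<lambda>x. complex_of_real (f (c *\<^sub>R x))))"
      unfolding eq by (rule integrable_mult_right)
    show "f (c *\<^sub>R 0) \<le> 0" using f'(6) by simp
    show "fourier_real (\<lambda>x. f (c *\<^sub>R x)) 0 \<le> 0"
      unfolding fr using f'(7) c by (simp add: divide_nonpos_pos)
  qed
qed

text \<open>
  Radii \<open>r\<close> and \<open>s\<close> beyond which \<open>f\<close> and its transform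
  are nonnegative can be chosen with \<open>r * s < \<rho>\<^sup>2\<close>; the dilation by
  \<open>sqrt (r / s)\<close> turns both into \<open>sqrt (r * s)\<close>.
\<close>

lemma competitor_above_product:
  fixes f :: "real ^ 'n \<Rightarrow> real"
  assumes f: "f \<in> admissible" and \<rho>: "\<rho> > 0"
    and less: "ennreal_sqrt (last_sign_change f * last_sign_change (fourier_real f)) < ennreal \<rho>"
  shows "\<exists>g :: real ^ 'n \<Rightarrow> real. g \<in> competitors \<rho> \<and> g \<noteq> (\<lambda>x. 0)"
proof -
  note f' = admissibleD[OF f] and F = admissible_fourier[OF f]
  let ?a = "last_sign_change f" and ?b = "last_sign_change (fourier_real f)"
  have a0: "?a \<noteq> 0"
    using f' by (intro last_sign_change_nonzero) (auto simp: fourier_real_0)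
  have "(LINT x|lborel. fourier_real f x) = f 0"
    using fourier_real_0[of "fourier_real f"] F(4)[of 0] by (simp add: fourier_real_def)
  then have b0: "?b \<noteq> 0"
    using F f'(6) by (intro last_sign_change_nonzero) auto
  have fin: "?a * ?b \<noteq> top"
    using less by (auto simp: ennreal_sqrt_def)
  then have "?a \<noteq> top" "?b \<noteq> top"
    using a0 b0 by (auto simp: ennreal_mult_eq_top_iff)
  then obtain \<alpha> \<beta> where \<alpha>: "?a = ennreal \<alpha>" "0 \<le> \<alpha>" and \<beta>: "?b = ennreal \<beta>" "0 \<le> \<beta>"
    by (metis ennreal_cases)
  have pos: "0 < \<alpha>" "0 < \<beta>" using a0 b0 \<alpha> \<beta> by (auto simp: less_le)
  have "sqrt (\<alpha> * \<beta>) < \<rho>"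
    using less \<alpha> \<beta> \<rho> by (simp add: ennreal_sqrt_def ennreal_mult[symmetric] ennreal_less_iff split: if_splits)
  then have "\<alpha> * \<beta> < \<rho>\<^sup>2"
    using pos \<rho> by (metis less_imp_le mult_pos_pos power_strict_mono real_sqrt_ge_zero real_sqrt_pow2 zero_less_numeral)
  then have "\<alpha> < \<rho>\<^sup>2 / \<beta>" using pos by (simp add: pos_less_divide_eq)
  then obtain r where r: "\<alpha> < r" "r < \<rho>\<^sup>2 / \<beta>" using dense by blast
  then have "r * \<beta> < \<rho>\<^sup>2" and r0: "0 < r" using pos by (simp_all add: pos_less_divide_eq)
  then have "\<beta> < \<rho>\<^sup>2 / r" by (simp add: pos_less_divide_eq mult.commute)
  then obtain s where s: "\<beta> < s" "s < \<rho>\<^sup>2 / r" using dense by blast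
  then have rs: "r * s < \<rho>\<^sup>2" and s0: "0 < s" using pos r0 by (simp_all add: pos_less_divide_eq mult.commute)
  define c where "c = sqrt (r / s)"
  have c: "0 < c" "c\<^sup>2 = r / s" using r0 s0 by (auto simp: c_def)
  have "r\<^sup>2 < (c * \<rho>)\<^sup>2"
  proof -
    have "r\<^sup>2 = (r / s) * (r * s)" using s0 by (simp add: power2_eq_square)
    also have "\<dots> < (r / s) * \<rho>\<^sup>2" using rs r0 s0 by (intro mult_strict_left_mono) auto
    finally show ?thesis by (simp add: power_mult_distrib c)
  qed
  then have cr: "r < c * \<rho>" by (rule power2_less_imp_less) (use c \<rho> in simp)
  have "(s * c)\<^sup>2 = s\<^sup>2 * (r / s)" by (simp only: power_mult_distrib c(2))
  also have "\<dots> = r * s" using s0 by (simp add: power2_eq_square)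
  finally have "(s * c)\<^sup>2 < \<rho>\<^sup>2" using rs by simp
  then have cs: "s * c < \<rho>" by (rule power2_less_imp_less) (use \<rho> in simp)
  show ?thesis
  proof (rule symmetrized_competitor[OF admissible_dilate(1)[OF f c(1)]])
    fix x :: "real ^ 'n" assume x: "norm x > \<rho>"
    have "r < norm (c *\<^sub>R x)"
      unfolding norm_scaleR abs_of_pos[OF c(1)] using cr mult_strict_left_mono[OF x c(1)] by linarith
    moreover have "?a < ennreal r" using \<alpha> r(1) by (simp add: ennreal_less_iff)
    ultimately show "0 \<le> f (c *\<^sub>R x)" by (rule last_sign_change_lessD[rotated])
    have "s < norm (x /\<^sub>R c)"
      using cs x c(1) by (simp add: pos_less_divide_eq divide_inverse_commute[symmetric])
    moreover have "?b < ennreal s" using \<beta> s(1) by (simp add: ennreal_less_iff)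
    ultimately have "0 \<le> fourier_real f (x /\<^sub>R c)" by (rule last_sign_change_lessD[rotated])
    then show "0 \<le> fourier_real (\<lambda>x. f (c *\<^sub>R x)) x"
      unfolding admissible_dilate(2)[OF f c(1)] using c(1) by simp
  qed
qed

lemma ennreal_sqrt_square: "ennreal_sqrt (a * a) = a"
proof (cases a)
  case (real r)
  then show ?thesis by (simp add: ennreal_sqrt_def ennreal_mult[symmetric])
next
  case top
  then show ?thesis by (simp add: ennreal_sqrt_def)
qed

lemma uncertainty_inf_le:
  fixes g :: "real ^ 'n \<Rightarrow> real"
  assumes g: "self_dual g" "g \<noteq> (\<lambda>x. 0)" "g 0 \<le> 0"
  shows "uncertainty_inf TYPE('n) \<le> last_sign_change g"
proof -
  have eq: "fourier (\<lambda>x. complex_of_real (g x)) = (\<lambda>y. complex_of_real (g y))"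
    using self_dual_fourier[OF g(1)] by auto
  then have fr: "fourier_real g = g" by (auto simp: fourier_real_def)
  have "g \<in> admissible"
    unfolding admissible_def mem_Collect_eq eq fr
    using g self_dual_even[OF g(1)] self_dual_continuous[OF g(1)] self_dual_integrable[OF g(1)] by simp
  then have "uncertainty_inf TYPE('n) \<le> ennreal_sqrt (last_sign_change g * last_sign_change (fourier_real g))"
    unfolding uncertainty_inf_def by (rule INF_lower)
  then show ?thesis by (simp add: fr ennreal_sqrt_square)
qed

text \<open>
  An explicit competitor: the Fourier transform exchanges \<open>gauss (x / 2)\<close> and
  \<open>2 ^ CARD('n) * gauss (2 * x)\<close>, so their sum is self-dual. Subtracting the
  multiple of \<open>gauss\<close> that cancels the value at 0 does not affect the sign far out,
  where the widest Gaussian dominates.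
\<close>

lemma uncertainty_inf_finite: "uncertainty_inf TYPE('n::finite) < top"
proof -
  let ?m = "2 ^ CARD('n) :: real"
  have half: "integrable lborel (\<lambda>x::real^'n. gauss ((1 / 2) *\<^sub>R x))" and two: "integrable lborel (\<lambda>x::real^'n. gauss (2 *\<^sub>R x))"
    using integrable_lborel_affine[of "1 / 2" "gauss :: real^'n \<Rightarrow> real" 0]
      integrable_lborel_affine[of 2 "gauss :: real^'n \<Rightarrow> real" 0] integrable_gauss by auto
  have fourier_half: "fourier (\<lambda>x. complex_of_real (gauss ((1 / 2) *\<^sub>R x))) y = complex_of_real (?m * gauss (2 *\<^sub>R y))" for y :: "real ^ 'n"
    by (subst fourier_scale[of "1 / 2" "\<lambda>x. complex_of_real (gauss x)"]) (simp_all add: fourier_gauss power_one_over)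
  have fourier_two: "fourier (\<lambda>x. complex_of_real (gauss (2 *\<^sub>R x))) y = complex_of_real (1 / ?m * gauss ((1 / 2) *\<^sub>R y))" for y :: "real ^ 'n"
    by (subst fourier_scale[of 2 "\<lambda>x. complex_of_real (gauss x)"]) (simp_all add: fourier_gauss)
  let ?H = "\<lambda>x::real ^ 'n. gauss ((1 / 2) *\<^sub>R x) + ?m * gauss (2 *\<^sub>R x)"
  have "fourier (\<lambda>x. complex_of_real (gauss ((1 / 2) *\<^sub>R x)) + of_real ?m * complex_of_real (gauss (2 *\<^sub>R x))) y =
      complex_of_real (?H y)" for y
    using half two by (subst fourier_add) (simp_all add: fourier_cmult fourier_half fourier_two del: of_real_power of_real_mult scaleR_half_double)
  then have H: "self_dual ?H"
    using half two by (simp add: self_dual_def)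
  let ?T = "\<lambda>x::real ^ 'n. ?H x + (- (1 + ?m)) * gauss x"
  have T: "self_dual ?T"
    by (intro self_dual_add H self_dual_cmult self_dual_gauss)
  have T_pos: "0 < ?T x" if x: "norm x > ?m" for x
  proof -
    have m: "1 \<le> ?m" by simp
    have "?m \<le> norm x * 1" using x by simp
    also have "\<dots> \<le> (norm x)\<^sup>2" unfolding power2_eq_square using x m by (intro mult_left_mono) linarith+
    also have "\<dots> \<le> (3 * pi / 4) * (norm x)\<^sup>2"
      using mult_right_mono[of 1 "3 * pi / 4" "(norm x)\<^sup>2"] pi_ge_two by simp
    finally have "1 + ?m \<le> 1 + (3 * pi / 4) * (norm x)\<^sup>2" by simp
    also have "\<dots> \<le> exp ((3 * pi / 4) * (norm x)\<^sup>2)" by (rule exp_ge_add_one_self)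
    finally have "(1 + ?m) * gauss x \<le> exp ((3 * pi / 4) * (norm x)\<^sup>2) * gauss x"
      using gauss_pos[of x] by (intro mult_right_mono) auto
    also have "\<dots> = gauss ((1 / 2) *\<^sub>R x)"
      by (simp add: gauss_def power_divide flip: exp_add)
    finally have "(1 + ?m) * gauss x \<le> gauss ((1 / 2) *\<^sub>R x)" .
    moreover have "0 < ?m * gauss (2 *\<^sub>R x)" by (intro mult_pos_pos gauss_pos) simp
    ultimately show ?thesis by (simp only: mult_minus_left)
  qed
  obtain x :: "real ^ 'n" where "norm x = ?m + 1"
    using vector_choose_size[of "?m + 1"] by auto
  then have "?T x \<noteq> 0" using T_pos[of x] by simp
  then have "?T \<noteq> (\<lambda>x. 0)" by (auto simp: fun_eq_iff)
  then have "uncertainty_inf TYPE('n) \<le> last_sign_change ?T"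
    by (intro uncertainty_inf_le T) simp_all
  also have "\<dots> \<le> ennreal ?m"
    using T_pos by (intro last_sign_change_le) (auto intro: less_imp_le)
  also have "\<dots> < top" by simp
  finally show ?thesis .
qed

theorem theorem3:
  shows "\<exists>f :: real ^ 'n::finite \<Rightarrow> real.
    f \<noteq> (\<lambda>x. 0) \<and>
    (\<forall>x y. norm x = norm y \<longrightarrow> f x = f y) \<and>
    integrable lborel f \<and>
    (\<forall>y. fourier (\<lambda>x. complex_of_real (f x)) y = complex_of_real (f y)) \<and>
    f 0 = 0 \<and> fourier (\<lambda>x. complex_of_real (f x)) 0 = 0 \<and>
    last_sign_change f = uncertainty_inf TYPE('n)"
proof -
  obtain a where a: "uncertainty_inf TYPE('n) = ennreal a" "0 \<le> a"
    using uncertainty_inf_finite[where 'n='n] by (cases "uncertainty_inf TYPE('n)") auto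
  define R where "R k = a + 1 / real (Suc k)" for k
  have R_pos: "0 < R k" for k using a by (simp add: R_def add_nonneg_pos)
  have R_dec: "R (Suc k) \<le> R k" for k by (simp add: R_def frac_le)
  have ex: "\<exists>g :: real ^ 'n \<Rightarrow> real. g \<in> competitors (R k) \<and> g \<noteq> (\<lambda>x. 0)" for k
  proof -
    have "uncertainty_inf TYPE('n) < ennreal (R k)" using a R_pos[of k] by (simp add: R_def ennreal_less_iff)
    then obtain f :: "real ^ 'n \<Rightarrow> real" where "f \<in> admissible"
      "ennreal_sqrt (last_sign_change f * last_sign_change (fourier_real f)) < ennreal (R k)"
      unfolding uncertainty_inf_def INF_less_iff by blast
    then show ?thesis by (intro competitor_above_product R_pos)
  qed
  obtain f :: "real ^ 'n \<Rightarrow> real" where f: "f \<noteq> (\<lambda>x. 0)" "self_dual f" "f 0 \<le> 0"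
    and radial: "\<And>x y. norm x = norm y \<Longrightarrow> f x = f y" and nonneg: "\<And>x k. norm x > R k \<Longrightarrow> 0 \<le> f x"
    using exists_radial_limit[of R, OF less_imp_le[OF R_pos] R_dec ex] by blast
  \<comment> \<open>\<open>- f 0\<close> is nonnegative, so this correction cannot create negative values\<close>
  define F where "F x = f x + (- f 0) * gauss x" for x
  have F: "self_dual F"
    unfolding F_def[abs_def] by (intro self_dual_add f self_dual_cmult self_dual_gauss)
  have F_0: "F 0 = 0" by (simp add: F_def)
  have F_ge: "f x \<le> F x" for x
    using f(3) gauss_pos[of x] by (simp add: F_def mult_nonpos_nonneg)
  have F_nz: "F \<noteq> (\<lambda>x. 0)"
  proof
    assume zero: "F = (\<lambda>x. 0)"
    have eq: "f x = f 0 * gauss x" for x using fun_cong[OF zero, of x] by (simp add: F_def)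
    obtain x :: "real ^ 'n" where "norm x = R 0 + 1"
      using vector_choose_size[of "R 0 + 1"] R_pos[of 0] by auto
    then have "0 \<le> f x" by (intro nonneg[of 0]) simp
    then have f_0: "f 0 = 0" using f(3) gauss_pos[of x] eq[of x] by (simp add: zero_le_mult_iff)
    have "f x = 0" for x using eq[of x] unfolding f_0 by simp
    then have "f = (\<lambda>x. 0)" by auto
    with f(1) show False by contradiction
  qed
  have sharp: "last_sign_change F = uncertainty_inf TYPE('n)"
  proof (rule antisym)
    show "uncertainty_inf TYPE('n) \<le> last_sign_change F"
      using F F_nz F_0 by (intro uncertainty_inf_le) auto
    show "last_sign_change F \<le> uncertainty_inf TYPE('n)"
    proof (rule ennreal_le_epsilon)
      fix e :: real assume e: "0 < e"
      then obtain k where k: "1 / real (Suc k) < e"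
        using nat_approx_posE by blast
      have "0 \<le> F x" if "norm x > a + e" for x
      proof -
        have "norm x > R k" using that k by (simp add: R_def)
        then show ?thesis using nonneg[of k x] F_ge[of x] by linarith
      qed
      then have "last_sign_change F \<le> ennreal (a + e)"
        using a e by (intro last_sign_change_le) auto
      then show "last_sign_change F \<le> uncertainty_inf TYPE('n) + ennreal e"
        using a e by (simp add: ennreal_plus)
    qed
  qed
  moreover have radial_F: "F x = F y" if "norm x = norm y" for x y
    using radial[OF that] that by (simp add: F_def gauss_def)
  moreover have "fourier (\<lambda>x. complex_of_real (F x)) 0 = 0"
    using self_dual_fourier[OF F, of 0] unfolding F_0 by simp
  ultimately show ?thesis
    using F_nz F_0 self_dual_fourier[OF F] self_dual_integrable[OF F] by blast
qed

end
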